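(* Let $M$ be a compact boundaryless Riemannian surface, let $f\in\mathrm{Diff}^1(M)$ and let $\Lambda\subset M$ be a compact $f$-invariant set such that $f_{|\Lambda}$ is sufficiently dissipative. Let $\Lambda'$ be the set of points of $\Lambda$ that do not belong to the basin of attraction of any attracting periodic orbit of $f$. Then for every integer $N\ge 1$, the restriction $f^N_{|\Lambda'}$ is far from homotheties.
   Context: Projective cocycle: for $x\in M$ and a unit vector $v\in T^1_xM$, put $G(v)=D_xf(v)/\|D_xf(v)\|$. For $n\in\mathbb Z$, $g^n(v)>0$ is the absolute value of the derivative at $v$ of $G^n: T^1_xM\to T^1_{f^n(x)}M$; equivalently $g^n(v)=|\det D_xf^n|/\|D_xf^n(v)\|^2$. Far from homotheties: for an invariant compact set $K$, $f_{|K}$ is far from homotheties if there is $\delta>0$ such that there are no $x\in K$ and $v\in T^1_xM$ with $(1-\delta)^n<g^n(v)<(1+\delta)^n$ for all $n\ge 1$. For $f^N_{|K}$ the definition is applied to the diffeomorphism $f^N$ (projective derivative $g^N$). Sufficiently dissipative: $f_{|\Lambda}$ is dissipative ($|\det D_xf|<1$ for all $x\in\Lambda$) and, with $b=\max_{x\in\Lambda}|\det D_xf|$ and $M_0=\max_{x\in\Lambda}\|D_xf\|$, one has $\sqrt b\,M_0+2b<\tfrac12$. An attracting periodic orbit is an asymptotically stable periodic orbit; its basin is the set of points whose forward orbits converge to it. *)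

theory Defs
  imports "HOL-Analysis.Analysis"
begin

section \<open>Smooth surfaces\<close>

text \<open>Only meant for open \<open>S\<close>.\<close>

primrec Ck_on :: "nat \<Rightarrow> ('a::euclidean_space \<Rightarrow> 'b::real_normed_vector) \<Rightarrow> 'a set \<Rightarrow> bool" where
  "Ck_on 0 f S \<longleftrightarrow> continuous_on S f"
| "Ck_on (Suc k) f S \<longleftrightarrow> (\<forall>x\<in>S. f differentiable (at x)) \<and>
     (\<forall>v. Ck_on k (\<lambda>x. frechet_derivative f (at x) v) S)"

definition smooth_on :: "'a::euclidean_space set \<Rightarrow> ('a \<Rightarrow> 'b::real_normed_vector) \<Rightarrow> bool" where
  "smooth_on S f \<longleftrightarrow> (\<forall>k. Ck_on k f S)"

text \<open>A chart is a pair of a domain and a coordinate map; the surface is the whole type \<open>'a\<close>.\<close>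

type_synonym 'a chart = "'a set \<times> ('a \<Rightarrow> real^2)"

abbreviation chart_dom :: "'a chart \<Rightarrow> 'a set" where
  "chart_dom c \<equiv> fst c"

abbreviation chart_map :: "'a chart \<Rightarrow> 'a \<Rightarrow> real^2" where
  "chart_map c \<equiv> snd c"

definition chart_inv :: "'a chart \<Rightarrow> real^2 \<Rightarrow> 'a" where
  "chart_inv c = inv_into (chart_dom c) (chart_map c)"

definition smooth_atlas :: "'a::topological_space chart set \<Rightarrow> bool" where
  "smooth_atlas A \<longleftrightarrow>
     (\<Union>c\<in>A. chart_dom c) = UNIV \<and>
     (\<forall>c\<in>A. open (chart_dom c) \<and> open (chart_map c ` chart_dom c) \<and>
        homeomorphism (chart_dom c) (chart_map c ` chart_dom c) (chart_map c) (chart_inv c)) \<and>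
     (\<forall>c\<in>A. \<forall>d\<in>A. smooth_on (chart_map c ` (chart_dom c \<inter> chart_dom d)) (chart_map d \<circ> chart_inv c))"

text \<open>
  The tangent space \<open>T\<^sub>xM\<close> is modelled by \<open>real^2\<close>, namely as the space of coordinate vectors
  in one distinguished chart \<open>chart_at A x\<close> around \<open>x\<close>. The map \<open>coord_vector A c x\<close> converts the
  coordinates of a tangent vector at \<open>x\<close> in an arbitrary chart \<open>c\<close> around \<open>x\<close> into this model.
  The distinguished chart may jump with \<open>x\<close>, so nothing below asks for regularity in \<open>x\<close> in the
  model itself: regularity is always expressed in the charts of the atlas.
\<close>

definition chart_at :: "'a chart set \<Rightarrow> 'a \<Rightarrow> 'a chart" where
  "chart_at A x = (SOME c. c \<in> A \<and> x \<in> chart_dom c)"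

definition coord_vector :: "'a chart set \<Rightarrow> 'a chart \<Rightarrow> 'a \<Rightarrow> real^2 \<Rightarrow> real^2" where
  "coord_vector A c x = frechet_derivative (chart_map (chart_at A x) \<circ> chart_inv c) (at (chart_map c x))"

definition tangent_map :: "'a chart set \<Rightarrow> ('a \<Rightarrow> 'a) \<Rightarrow> 'a \<Rightarrow> real^2 \<Rightarrow> real^2" where
  "tangent_map A f x =
     frechet_derivative (chart_map (chart_at A (f x)) \<circ> f \<circ> chart_inv (chart_at A x))
       (at (chart_map (chart_at A x) x))"

definition C1_map :: "'a::topological_space chart set \<Rightarrow> ('a \<Rightarrow> 'a) \<Rightarrow> bool" where
  "C1_map A f \<longleftrightarrow> continuous_on UNIV f \<and>
     (\<forall>c\<in>A. \<forall>d\<in>A. Ck_on 1 (chart_map d \<circ> f \<circ> chart_inv c)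
        (chart_map c ` (chart_dom c \<inter> f -` chart_dom d)))"

definition C1_diffeo :: "'a::topological_space chart set \<Rightarrow> ('a \<Rightarrow> 'a) \<Rightarrow> bool" where
  "C1_diffeo A f \<longleftrightarrow> bij f \<and> C1_map A f \<and> C1_map A (inv f)"


section \<open>Riemannian metrics\<close>

type_synonym 'a metric_tensor = "'a \<Rightarrow> real^2 \<Rightarrow> real^2 \<Rightarrow> real"

text \<open>
  \<open>g x\<close> is an inner product on \<open>T\<^sub>xM\<close>, and the coefficients of \<open>g\<close> are smooth in every chart.
\<close>

definition riemannian_metric :: "'a chart set \<Rightarrow> 'a metric_tensor \<Rightarrow> bool" where
  "riemannian_metric A g \<longleftrightarrow>
     (\<forall>x. bilinear (g x) \<and> (\<forall>u v. g x u v = g x v u) \<and> (\<forall>v. v \<noteq> 0 \<longrightarrow> g x v v > 0)) \<and>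
     (\<forall>c\<in>A. \<forall>u v. smooth_on (chart_map c ` chart_dom c)
        (\<lambda>p. g (chart_inv c p) (coord_vector A c (chart_inv c p) u) (coord_vector A c (chart_inv c p) v)))"

definition riemannian_surface :: "'a::t2_space chart set \<Rightarrow> 'a metric_tensor \<Rightarrow> bool" where
  "riemannian_surface A g \<longleftrightarrow> smooth_atlas A \<and> riemannian_metric A g"

definition rnorm :: "'a metric_tensor \<Rightarrow> 'a \<Rightarrow> real^2 \<Rightarrow> real" where
  "rnorm g x v = sqrt (g x v v)"

definition unit_tangent :: "'a metric_tensor \<Rightarrow> 'a \<Rightarrow> (real^2) set" where
  "unit_tangent g x = {v. rnorm g x v = 1}"

definition tangent_opnorm :: "'a chart set \<Rightarrow> 'a metric_tensor \<Rightarrow> ('a \<Rightarrow> 'a) \<Rightarrow> 'a \<Rightarrow> real" where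
  "tangent_opnorm A g f x = (SUP v\<in>unit_tangent g x. rnorm g (f x) (tangent_map A f x v))"

text \<open>
  \<open>|det D\<^sub>xf|\<close> is taken with respect to the inner products on \<open>T\<^sub>xM\<close> and \<open>T\<^bsub>f x\<^esub>M\<close>,
  that is, with respect to orthonormal bases (see \<open>abs_det_orthonormal\<close> below).
\<close>

definition gram :: "'a metric_tensor \<Rightarrow> 'a \<Rightarrow> real^2^2" where
  "gram g x = (\<chi> i j. g x (axis i 1) (axis j 1))"

definition abs_det :: "'a chart set \<Rightarrow> 'a metric_tensor \<Rightarrow> ('a \<Rightarrow> 'a) \<Rightarrow> 'a \<Rightarrow> real" where
  "abs_det A g f x =
     \<bar>det (matrix (tangent_map A f x))\<bar> * sqrt (det (gram g (f x))) / sqrt (det (gram g x))"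


section \<open>The projective cocycle\<close>

definition projective_map ::
  "'a chart set \<Rightarrow> 'a metric_tensor \<Rightarrow> ('a \<Rightarrow> 'a) \<Rightarrow> 'a \<times> (real^2) \<Rightarrow> 'a \<times> (real^2)" where
  "projective_map A g f = (\<lambda>(x, v).
     (f x, tangent_map A f x v /\<^sub>R rnorm g (f x) (tangent_map A f x v)))"

text \<open>
  The unit circle \<open>T\<^sup>1\<^sub>xM\<close> is parametrised by arc length near \<open>v\<close> as
  \<open>\<theta> \<mapsto> cos \<theta> v + sin \<theta> w\<close>, where \<open>w\<close> is a unit vector orthogonal to \<open>v\<close>; the
  absolute value of the derivative of \<open>G\<^sup>n\<close> at \<open>v\<close> is the norm of the velocity of the image curve.
  Replacing \<open>w\<close> by \<open>-w\<close> only changes the sign of that velocity. The closed formula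
  \<open>|det D\<^sub>xf\<^sup>n| / \<parallel>D\<^sub>xf\<^sup>n(v)\<parallel>\<^sup>2\<close> is \<open>projective_deriv_eq\<close> below.
\<close>

definition unit_normal :: "'a metric_tensor \<Rightarrow> 'a \<Rightarrow> real^2 \<Rightarrow> real^2" where
  "unit_normal g x v = (SOME w. w \<in> unit_tangent g x \<and> g x v w = 0)"

definition projective_deriv ::
  "'a chart set \<Rightarrow> 'a metric_tensor \<Rightarrow> ('a \<Rightarrow> 'a) \<Rightarrow> nat \<Rightarrow> 'a \<Rightarrow> real^2 \<Rightarrow> real" where
  "projective_deriv A g f n x v = rnorm g ((f ^^ n) x)
     (vector_derivative
        (\<lambda>\<theta>. snd ((projective_map A g f ^^ n) (x, cos \<theta> *\<^sub>R v + sin \<theta> *\<^sub>R unit_normal g x v)))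
        (at 0))"

text \<open>
  The bound \<open>\<delta> < 1\<close> is implicit in the notion: for \<open>\<delta> > 2\<close> the numbers \<open>(1 - \<delta>) ^ n\<close> with \<open>n\<close>
  even are large, and the condition would hold for every map once \<open>\<delta>\<close> is large.
\<close>

definition far_from_homotheties ::
  "'a chart set \<Rightarrow> 'a metric_tensor \<Rightarrow> ('a \<Rightarrow> 'a) \<Rightarrow> 'a set \<Rightarrow> bool" where
  "far_from_homotheties A g f K \<longleftrightarrow>
     (\<exists>\<delta>. 0 < \<delta> \<and> \<delta> < 1 \<and>
        \<not> (\<exists>x\<in>K. \<exists>v\<in>unit_tangent g x. \<forall>n\<ge>1.
              (1 - \<delta>) ^ n < projective_deriv A g f n x v \<and>
              projective_deriv A g f n x v < (1 + \<delta>) ^ n))"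

definition sufficiently_dissipative ::
  "'a chart set \<Rightarrow> 'a metric_tensor \<Rightarrow> ('a \<Rightarrow> 'a) \<Rightarrow> 'a set \<Rightarrow> bool" where
  "sufficiently_dissipative A g f L \<longleftrightarrow>
     (\<forall>x\<in>L. abs_det A g f x < 1) \<and>
     (let b = (SUP x\<in>L. abs_det A g f x);
          M0 = (SUP x\<in>L. tangent_opnorm A g f x)
      in sqrt b * M0 + 2 * b < 1 / 2)"


section \<open>Attracting periodic orbits\<close>

definition periodic_orbit :: "('a \<Rightarrow> 'a) \<Rightarrow> 'a set \<Rightarrow> bool" where
  "periodic_orbit f S \<longleftrightarrow> (\<exists>p n. n \<ge> 1 \<and> (f ^^ n) p = p \<and> S = {(f ^^ k) p | k. True})"

text \<open>
  For a finite set \<open>S\<close> in a metrizable space, this says that the distance of the \<open>k\<close>-th iterate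
  to \<open>S\<close> tends to 0.
\<close>

definition orbit_converges_to :: "('a::topological_space \<Rightarrow> 'a) \<Rightarrow> 'a set \<Rightarrow> 'a \<Rightarrow> bool" where
  "orbit_converges_to f S y \<longleftrightarrow>
     (\<forall>U. open U \<and> S \<subseteq> U \<longrightarrow> (\<forall>\<^sub>F k in sequentially. (f ^^ k) y \<in> U))"

definition basin :: "('a::topological_space \<Rightarrow> 'a) \<Rightarrow> 'a set \<Rightarrow> 'a set" where
  "basin f S = {y. orbit_converges_to f S y}"

definition asymptotically_stable :: "('a::topological_space \<Rightarrow> 'a) \<Rightarrow> 'a set \<Rightarrow> bool" where
  "asymptotically_stable f S \<longleftrightarrow>
     (\<forall>U. open U \<and> S \<subseteq> U \<longrightarrow> (\<exists>V. open V \<and> S \<subseteq> V \<and> (\<forall>k. (f ^^ k) ` V \<subseteq> U))) \<and>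
     (\<exists>W. open W \<and> S \<subseteq> W \<and> W \<subseteq> basin f S)"

definition attracting_periodic_orbit :: "('a::topological_space \<Rightarrow> 'a) \<Rightarrow> 'a set \<Rightarrow> bool" where
  "attracting_periodic_orbit f S \<longleftrightarrow> periodic_orbit f S \<and> asymptotically_stable f S"

definition outside_basins :: "('a::topological_space \<Rightarrow> 'a) \<Rightarrow> 'a set \<Rightarrow> 'a set" where
  "outside_basins f L = {x \<in> L. \<not> (\<exists>S. attracting_periodic_orbit f S \<and> x \<in> basin f S)}"


section \<open>Consistency of the definitions\<close>


lemma bilinear_gram_expand:
  assumes "bilinear (g x)"
  shows "g x u v = u$1 * v$1 * gram g x $1$1 + u$1 * v$2 * gram g x $1$2
     + u$2 * v$1 * gram g x $2$1 + u$2 * v$2 * gram g x $2$2"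
proof -
  have e: "y = (y$1) *\<^sub>R axis 1 1 + (y$2) *\<^sub>R axis 2 (1::real)" for y :: "real^2"
    by (simp add: vec_eq_iff forall_2 axis_def)
  have "g x u v = g x ((u$1) *\<^sub>R axis 1 1 + (u$2) *\<^sub>R axis 2 1) ((v$1) *\<^sub>R axis 1 1 + (v$2) *\<^sub>R axis 2 1)"
    using e[of u] e[of v] by simp
  then show ?thesis
    using assms
    by (simp add: bilinear_ladd bilinear_radd bilinear_lmul bilinear_rmul gram_def algebra_simps)
qed

lemma gram_sym: "riemannian_metric A g \<Longrightarrow> gram g x $2$1 = gram g x $1$2"
  by (simp add: riemannian_metric_def gram_def)

lemma gram_orthonormal:
  assumes "riemannian_metric A g" "g x u u = 1" "g x v v = 1" "g x u v = 0"
  shows "det (gram g x) * (u$1 * v$2 - u$2 * v$1)^2 = 1"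
proof -
  have bl: "bilinear (g x)" using assms(1) by (simp add: riemannian_metric_def)
  note s = gram_sym[OF assms(1), of x]
  note ex = bilinear_gram_expand[of g x, OF bl]
  have "det (gram g x) * (u$1 * v$2 - u$2 * v$1)^2 = g x u u * g x v v - (g x u v)^2"
    unfolding ex[of u u] ex[of v v] ex[of u v] det_2 s by algebra
  then show ?thesis using assms by simp
qed

lemma linear_matrix_entries:
  fixes T :: "real^2 \<Rightarrow> real^2"
  assumes "linear T"
  shows "T u $ i = matrix T $ i $ 1 * u$1 + matrix T $ i $ 2 * u$2"
proof -
  have "T u = matrix T *v u" using assms by (simp add: matrix_works)
  then show ?thesis by (simp add: matrix_vector_mult_def sum_2)
qed

lemma abs_det_orthonormal:
  assumes g: "riemannian_metric A g" and lin: "linear (tangent_map A f x)"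
    and e: "g x e1 e1 = 1" "g x e2 e2 = 1" "g x e1 e2 = 0"
    and w: "g (f x) w1 w1 = 1" "g (f x) w2 w2 = 1" "g (f x) w1 w2 = 0"
  defines "a \<equiv> \<lambda>w e. g (f x) w (tangent_map A f x e)"
  shows "abs_det A g f x = \<bar>a w1 e1 * a w2 e2 - a w1 e2 * a w2 e1\<bar>"
proof -
  define T where "T = tangent_map A f x"
  define DE where "DE = e1$1 * e2$2 - e1$2 * e2$1"
  define DW where "DW = w1$1 * w2$2 - w1$2 * w2$1"
  define dG where "dG = det (gram g x)"
  define dH where "dH = det (gram g (f x))"
  have bl: "bilinear (g y)" for y using g by (simp add: riemannian_metric_def)
  have G: "dG * DE^2 = 1" "dH * DW^2 = 1"
    using gram_orthonormal[OF g e] gram_orthonormal[OF g w]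
    by (simp_all add: dG_def dH_def DE_def DW_def)
  have pos: "dG > 0" "dH > 0"
    using G by (metis mult_eq_0_iff not_less_iff_gr_or_eq zero_le_power2 zero_less_mult_iff zero_less_one zero_neq_one not_le)+
  have sq: "sqrt dG * \<bar>DE\<bar> = 1" "sqrt dH * \<bar>DW\<bar> = 1"
    using arg_cong[OF G(1), of sqrt] arg_cong[OF G(2), of sqrt] by (simp_all add: real_sqrt_mult)
  have "a w1 e1 * a w2 e2 - a w1 e2 * a w2 e1 = DW * dH * det (matrix T) * DE"
    unfolding a_def T_def[symmetric] bilinear_gram_expand[of g "f x", OF bl] linear_matrix_entries[OF lin[folded T_def]]
      DW_def DE_def dH_def det_2 gram_sym[OF g] by algebra
  then have "\<bar>a w1 e1 * a w2 e2 - a w1 e2 * a w2 e1\<bar> = \<bar>DW\<bar> * dH * \<bar>det (matrix T)\<bar> * \<bar>DE\<bar>"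
    using pos by (simp add: abs_mult)
  also have "\<dots> = (sqrt dH * \<bar>DW\<bar>) * sqrt dH * \<bar>det (matrix T)\<bar> * \<bar>DE\<bar>"
    using pos by simp
  also have "\<dots> = sqrt dH * \<bar>det (matrix T)\<bar> * \<bar>DE\<bar>" using sq by simp
  also have "\<bar>DE\<bar> = 1 / sqrt dG" using sq pos by (simp add: field_simps)
  finally show ?thesis by (simp add: abs_det_def T_def dG_def dH_def)
qed

lemma chart_at:
  assumes "smooth_atlas A" shows "chart_at A x \<in> A" "x \<in> chart_dom (chart_at A x)"
proof -
  have "x \<in> (\<Union>c\<in>A. chart_dom c)" using assms by (simp add: smooth_atlas_def)
  then have "\<exists>c. c \<in> A \<and> x \<in> chart_dom c" by blast
  from someI_ex[OF this] show "chart_at A x \<in> A" "x \<in> chart_dom (chart_at A x)"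
    by (simp_all add: chart_at_def)
qed

lemma chart_inv_chart_map:
  assumes "smooth_atlas A" "c \<in> A" "x \<in> chart_dom c"
  shows "chart_inv c (chart_map c x) = x"
  using assms by (auto simp: smooth_atlas_def homeomorphism_def)

lemma eventually_chart_inv:
  assumes A: "smooth_atlas A" "c \<in> A" "x \<in> chart_dom c" and U: "open U" "x \<in> U"
  shows "\<forall>\<^sub>F p in nhds (chart_map c x). chart_inv c p \<in> U"
proof -
  have 1: "open (chart_map c ` chart_dom c)" "continuous_on (chart_map c ` chart_dom c) (chart_inv c)"
    using A by (auto simp: smooth_atlas_def homeomorphism_def)
  have "isCont (chart_inv c) (chart_map c x)"
    using 1 A(3) by (simp add: continuous_on_eq_continuous_at)
  then show ?thesis
    using chart_inv_chart_map[OF A] U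
    by (metis isCont_def tendsto_at_iff_tendsto_nhds topological_tendstoD)
qed

lemma tangent_map_has_derivative:
  assumes A: "smooth_atlas A" and f: "C1_map A f"
  shows "((chart_map (chart_at A (f x)) \<circ> f \<circ> chart_inv (chart_at A x)) has_derivative tangent_map A f x)
     (at (chart_map (chart_at A x) x))"
proof -
  have "Ck_on (Suc 0) (chart_map (chart_at A (f x)) \<circ> f \<circ> chart_inv (chart_at A x))
     (chart_map (chart_at A x) ` (chart_dom (chart_at A x) \<inter> f -` chart_dom (chart_at A (f x))))"
    using f chart_at(1)[OF A] by (simp add: C1_map_def)
  moreover have "x \<in> chart_dom (chart_at A x) \<inter> f -` chart_dom (chart_at A (f x))"
    using chart_at(2)[OF A] by auto
  ultimately have "(chart_map (chart_at A (f x)) \<circ> f \<circ> chart_inv (chart_at A x)) differentiable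
      (at (chart_map (chart_at A x) x))" by auto
  then show ?thesis unfolding tangent_map_def by (simp add: frechet_derivative_works)
qed

lemma tangent_map_id:
  assumes A: "smooth_atlas A" shows "tangent_map A id x = id"
proof -
  let ?c = "chart_at A x"
  note c = chart_at[OF A, of x]
  have "open (chart_map ?c ` chart_dom ?c)" using A c(1) by (simp add: smooth_atlas_def)
  moreover have "\<And>p. p \<in> chart_map ?c ` chart_dom ?c \<Longrightarrow> id p = (chart_map ?c \<circ> id \<circ> chart_inv ?c) p"
    using chart_inv_chart_map[OF A c(1)] by auto
  ultimately have "((chart_map ?c \<circ> id \<circ> chart_inv ?c) has_derivative id) (at (chart_map ?c x))"
    using c(2) by (intro has_derivative_transform_within_open[OF has_derivative_id[unfolded id_def[symmetric]]]) auto
  then show ?thesis unfolding tangent_map_def using frechet_derivative_at by fastforce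
qed

lemma tangent_map_comp:
  assumes A: "smooth_atlas A" and h: "continuous_on UNIV h"
   and dh: "((chart_map (chart_at A (h x)) \<circ> h \<circ> chart_inv (chart_at A x)) has_derivative tangent_map A h x)
     (at (chart_map (chart_at A x) x))"
   and f: "C1_map A f"
  shows "((chart_map (chart_at A (f (h x))) \<circ> (f \<circ> h) \<circ> chart_inv (chart_at A x)) has_derivative tangent_map A (f \<circ> h) x)
     (at (chart_map (chart_at A x) x))"
    and "tangent_map A (f \<circ> h) x = tangent_map A f (h x) \<circ> tangent_map A h x"
proof -
  let ?c = "chart_at A x" and ?d = "chart_at A (h x)" and ?e = "chart_at A (f (h x))"
  note c = chart_at[OF A, of x] and d = chart_at[OF A, of "h x"]
  have v: "(chart_map ?d \<circ> h \<circ> chart_inv ?c) (chart_map ?c x) = chart_map ?d (h x)"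
    using chart_inv_chart_map[OF A c] by simp
  have 1: "((chart_map ?e \<circ> f \<circ> chart_inv ?d) \<circ> (chart_map ?d \<circ> h \<circ> chart_inv ?c) has_derivative
     tangent_map A f (h x) \<circ> tangent_map A h x) (at (chart_map ?c x))"
    by (rule diff_chain_at[OF dh]) (use tangent_map_has_derivative[OF A f, of "h x"] v in simp)
  have "open (chart_dom ?d)" using A d by (simp add: smooth_atlas_def)
  then have "open (h -` chart_dom ?d)" using h by (simp add: continuous_on_open_vimage)
  then have "\<forall>\<^sub>F p in nhds (chart_map ?c x). chart_inv ?c p \<in> h -` chart_dom ?d"
    using eventually_chart_inv[OF A c, of "h -` chart_dom ?d"] d by blast
  then obtain S where S: "open S" "chart_map ?c x \<in> S" "\<And>p. p \<in> S \<Longrightarrow> h (chart_inv ?c p) \<in> chart_dom ?d"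
    by (auto simp: eventually_nhds)
  have 2: "((chart_map ?e \<circ> (f \<circ> h) \<circ> chart_inv ?c) has_derivative
     tangent_map A f (h x) \<circ> tangent_map A h x) (at (chart_map ?c x))"
    by (rule has_derivative_transform_within_open[OF 1 S(1,2)])
       (use S(3) chart_inv_chart_map[OF A d(1)] in simp)
  then show 3: "tangent_map A (f \<circ> h) x = tangent_map A f (h x) \<circ> tangent_map A h x"
    unfolding tangent_map_def[of A "f \<circ> h"] using frechet_derivative_at by fastforce
  show "((chart_map ?e \<circ> (f \<circ> h) \<circ> chart_inv ?c) has_derivative tangent_map A (f \<circ> h) x)
     (at (chart_map ?c x))" using 2 3 by simp
qed

lemma tangent_map_funpow:
  assumes A: "smooth_atlas A" and f: "C1_map A f"
  shows "continuous_on UNIV (f ^^ n) \<and> ((chart_map (chart_at A ((f ^^ n) x)) \<circ> (f ^^ n) \<circ> chart_inv (chart_at A x)) has_derivative tangent_map A (f ^^ n) x)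
     (at (chart_map (chart_at A x) x))"
proof (induction n)
  case 0
  have "((chart_map (chart_at A x) \<circ> id \<circ> chart_inv (chart_at A x)) has_derivative id) (at (chart_map (chart_at A x) x))"
  proof -
    note c = chart_at[OF A, of x]
    have "open (chart_map (chart_at A x) ` chart_dom (chart_at A x))" using A c(1) by (simp add: smooth_atlas_def)
    moreover have "\<And>p. p \<in> chart_map (chart_at A x) ` chart_dom (chart_at A x) \<Longrightarrow> id p = (chart_map (chart_at A x) \<circ> id \<circ> chart_inv (chart_at A x)) p"
      using chart_inv_chart_map[OF A c(1)] by auto
    ultimately show ?thesis
      using c(2) by (intro has_derivative_transform_within_open[OF has_derivative_id[unfolded id_def[symmetric]]]) auto
  qed
  then show ?case using tangent_map_id[OF A, of x] by (simp add: id_def o_def)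
next
  case (Suc n)
  have "continuous_on UNIV (f \<circ> (f ^^ n))"
    using Suc f continuous_on_subset[of UNIV f "range (f ^^ n)"]
    by (intro continuous_on_compose) (simp_all add: C1_map_def)
  moreover have "(f \<circ> (f ^^ n)) x = f ((f ^^ n) x)" by simp
  ultimately show ?case
    using tangent_map_comp(1)[OF A conjunct1[OF Suc] conjunct2[OF Suc] f]
    by (metis funpow.simps(2))
qed

lemma tangent_map_Suc:
  assumes A: "smooth_atlas A" and f: "C1_map A f"
  shows "tangent_map A (f ^^ Suc n) x v = tangent_map A f ((f ^^ n) x) (tangent_map A (f ^^ n) x v)"
  using tangent_map_comp(2)[OF A _ _ f, of "f ^^ n" x] tangent_map_funpow[OF A f, of n x] by simp

lemma tangent_map_nonzero:
  assumes A: "smooth_atlas A" and f: "C1_diffeo A f" and "v \<noteq> 0"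
  shows "tangent_map A f x v \<noteq> 0"
proof -
  have f': "C1_map A f" "C1_map A (inv f)" "bij f" using f by (auto simp: C1_diffeo_def)
  have "tangent_map A (inv f \<circ> f) x = tangent_map A (inv f) (f x) \<circ> tangent_map A f x"
    using f' tangent_map_comp(2)[OF A _ tangent_map_has_derivative[OF A f'(1)] f'(2)]
    by (simp add: C1_map_def)
  then have "tangent_map A (inv f) (f x) (tangent_map A f x v) = v"
    using f'(3) tangent_map_id[OF A, of x] by (metis bij_is_inj comp_apply id_apply inv_o_cancel)
  moreover have "linear (tangent_map A (inv f) (f x))"
    using tangent_map_has_derivative[OF A f'(2)] has_derivative_linear by blast
  ultimately show ?thesis using \<open>v \<noteq> 0\<close> linear_0 by metis
qed

lemma projective_map_funpow:
  assumes A: "riemannian_surface A g" and f: "C1_diffeo A f" and v: "v \<in> unit_tangent g x"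
  defines "B \<equiv> \<lambda>n. tangent_map A (f ^^ n) x v"
  shows "B n \<noteq> 0 \<and> (projective_map A g f ^^ n) (x, v) = ((f ^^ n) x, B n /\<^sub>R rnorm g ((f ^^ n) x) (B n))"
proof (induction n)
  case 0
  have "bilinear (g x)" using A by (simp add: riemannian_surface_def riemannian_metric_def)
  then have "v \<noteq> 0" using v by (auto simp: unit_tangent_def rnorm_def bilinear_lzero)
  then show ?case using v A tangent_map_id[of A x]
    by (simp add: B_def unit_tangent_def riemannian_surface_def id_def)
next
  case (Suc n)
  have A': "smooth_atlas A" "riemannian_metric A g" using A by (auto simp: riemannian_surface_def)
  have f': "C1_map A f" using f by (simp add: C1_diffeo_def)
  let ?y = "(f ^^ n) x" and ?r = "rnorm g ((f ^^ n) x) (B n)"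
  define T where "T = tangent_map A f ?y"
  have T: "linear T"
    unfolding T_def using tangent_map_has_derivative[OF A'(1) f'] has_derivative_linear by blast
  have B: "B (Suc n) = T (B n)" unfolding B_def T_def by (rule tangent_map_Suc[OF A'(1) f'])
  have nz: "B (Suc n) \<noteq> 0" unfolding B T_def using Suc tangent_map_nonzero[OF A'(1) f] by blast
  have r: "?r > 0" using Suc A'(2) by (simp add: rnorm_def riemannian_metric_def)
  have bl: "bilinear (g (f ?y))" using A'(2) by (simp add: riemannian_metric_def)
  have "T (B n /\<^sub>R ?r) = T (B n) /\<^sub>R ?r" using T by (simp add: linear_cmul)
  moreover have "rnorm g (f ?y) (T (B n) /\<^sub>R ?r) = rnorm g (f ?y) (T (B n)) / ?r"
    using r by (simp add: rnorm_def bilinear_lmul[OF bl] bilinear_rmul[OF bl] real_sqrt_mult real_sqrt_divide field_simps)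
  ultimately show ?case using nz Suc r by (simp add: projective_map_def T_def[symmetric] B inverse_eq_divide)
qed

lemma unit_normal_exists:
  assumes g: "riemannian_metric A g" and v: "v \<in> unit_tangent g x"
  shows "unit_normal g x v \<in> unit_tangent g x \<and> g x v (unit_normal g x v) = 0"
proof -
  have bl: "bilinear (g x)" using g by (simp add: riemannian_metric_def)
  have v1: "g x v v = 1" using v by (simp add: unit_tangent_def rnorm_def)
  obtain u where u: "u \<notin> span {v}"
  proof -
    have "dim (span {v}) \<le> 1" by (simp add: dim_le_card' order_trans)
    moreover have "dim (UNIV :: (real^2) set) = 2" by simp
    ultimately have "span {v} \<noteq> UNIV" by (metis one_le_numeral not_less numeral_le_one_iff semiring_norm(69))
    then show ?thesis using that by blast
  qed
  define z where "z = u - g x v u *\<^sub>R v"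
  have "z \<noteq> 0" unfolding z_def using u by (metis eq_iff_diff_eq_0 span_base span_scale singletonI)
  have "g x v z = 0" unfolding z_def by (simp add: bilinear_rsub[OF bl] bilinear_rmul[OF bl] v1)
  moreover have zz: "g x z z > 0" using g \<open>z \<noteq> 0\<close> by (simp add: riemannian_metric_def)
  moreover define w where "w = z /\<^sub>R sqrt (g x z z)"
  ultimately have "w \<in> unit_tangent g x \<and> g x v w = 0"
    by (simp add: unit_tangent_def rnorm_def bilinear_lmul[OF bl] bilinear_rmul[OF bl] field_simps)
  then show ?thesis unfolding unit_normal_def by (rule someI)
qed

lemma projective_deriv_eq:
  assumes A: "riemannian_surface A g" and f: "C1_diffeo A f" and v: "v \<in> unit_tangent g x"
  shows "projective_deriv A g f n x v =
     abs_det A g (f ^^ n) x / (rnorm g ((f ^^ n) x) (tangent_map A (f ^^ n) x v))\<^sup>2"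
proof -
  have A': "smooth_atlas A" "riemannian_metric A g" using A by (auto simp: riemannian_surface_def)
  have f': "C1_map A f" using f by (simp add: C1_diffeo_def)
  define w where "w = unit_normal g x v"
  define y where "y = (f ^^ n) x"
  define B where "B = tangent_map A (f ^^ n) x"
  have bl: "bilinear (g z)" for z using A' by (simp add: riemannian_metric_def)
  have sym: "g z a b = g z b a" for z a b using A'(2) by (simp add: riemannian_metric_def)
  have w: "g x w w = 1" "g x v w = 0" "g x w v = 0" and v1: "g x v v = 1"
    using unit_normal_exists[OF A'(2) v] v sym[of x w v]
    by (simp_all add: w_def unit_tangent_def rnorm_def)
  have lin: "linear B" unfolding B_def using tangent_map_funpow[OF A'(1) f'] has_derivative_linear by blast
  define p where "p = B v" define q where "q = B w"
  define a where "a = g y p p" define b where "b = g y p q" define c where "c = g y q q"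
  have expand: "g z (\<alpha> *\<^sub>R s + \<beta> *\<^sub>R t) (\<alpha> *\<^sub>R s + \<beta> *\<^sub>R t)
      = \<alpha>\<^sup>2 * g z s s + 2 * \<beta> * \<alpha> * g z s t + \<beta>\<^sup>2 * g z t t" for z s t \<alpha> \<beta>
    unfolding bilinear_ladd[OF bl] bilinear_radd[OF bl] bilinear_lmul[OF bl] bilinear_rmul[OF bl]
      sym[of z t s] power2_eq_square real_scaleR_def by (simp only: ring_distribs) simp
  have unit: "cos t *\<^sub>R v + sin t *\<^sub>R w \<in> unit_tangent g x" for t
    by (simp add: unit_tangent_def rnorm_def expand w v1)
  have Bt: "B (cos t *\<^sub>R v + sin t *\<^sub>R w) = cos t *\<^sub>R p + sin t *\<^sub>R q" for t
    by (simp add: linear_add[OF lin] linear_cmul[OF lin] p_def q_def)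
  define Q where "Q = (\<lambda>t. (cos t)\<^sup>2 * a + 2 * sin t * cos t * b + (sin t)\<^sup>2 * c)"
  have nrm: "rnorm g y (cos t *\<^sub>R p + sin t *\<^sub>R q) = sqrt (Q t)" for t
    by (simp add: rnorm_def expand Q_def a_def b_def c_def)
  have curve: "snd ((projective_map A g f ^^ n) (x, cos t *\<^sub>R v + sin t *\<^sub>R w))
     = inverse (sqrt (Q t)) *\<^sub>R (cos t *\<^sub>R p + sin t *\<^sub>R q)" for t
    using projective_map_funpow[OF A f unit, of n t] by (simp add: B_def[symmetric] Bt y_def[symmetric] nrm)
  have "p \<noteq> 0" using projective_map_funpow[OF A f v, of n] by (simp add: p_def B_def)
  then have a: "a > 0" using A'(2) by (simp add: a_def riemannian_metric_def)
  define k where "k = - b / (a * sqrt a)"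
  have dQ: "((\<lambda>t. inverse (sqrt (Q t))) has_real_derivative k) (at 0)"
  proof -
    have "(Q has_real_derivative 2 * b) (at 0)"
      unfolding Q_def by (auto intro!: derivative_eq_intros)
    moreover have "Q 0 = a" by (simp add: Q_def)
    ultimately have "((\<lambda>t. sqrt (Q t)) has_real_derivative inverse (sqrt a) / 2 * (2 * b)) (at 0)"
      using DERIV_chain2[OF DERIV_real_sqrt, of Q 0 "2 * b" UNIV] a by simp
    from DERIV_inverse_fun[OF this] \<open>Q 0 = a\<close> a show ?thesis
      by (simp add: k_def divide_simps mult.commute)
  qed
  have "((\<lambda>t. inverse (sqrt (Q t)) *\<^sub>R (cos t *\<^sub>R p + sin t *\<^sub>R q)) has_vector_derivative
     inverse (sqrt a) *\<^sub>R q + k *\<^sub>R p) (at 0)"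
  proof -
    have "((\<lambda>t. cos t *\<^sub>R p + sin t *\<^sub>R q) has_vector_derivative q) (at 0)"
      by (auto intro!: derivative_eq_intros)
    from has_vector_derivative_scaleR[OF dQ this] show ?thesis by (simp add: Q_def)
  qed
  then have "projective_deriv A g f n x v = rnorm g y (inverse (sqrt a) *\<^sub>R q + k *\<^sub>R p)"
    unfolding projective_deriv_def w_def[symmetric] y_def[symmetric] curve
    by (simp add: vector_derivative_at)
  also have "\<dots> = sqrt (c / a + 2 * k * b / sqrt a + k\<^sup>2 * a)"
    unfolding rnorm_def expand a_def[symmetric] c_def[symmetric] sym[of y q p] b_def[symmetric]
    using a by (simp add: divide_simps)
  also have "c / a + 2 * k * b / sqrt a + k\<^sup>2 * a = (a * c - b\<^sup>2) / a\<^sup>2"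
    using a by (simp add: k_def field_simps power2_eq_square)
  finally have 1: "projective_deriv A g f n x v = sqrt (a * c - b\<^sup>2) / a"
    using a by (simp add: real_sqrt_divide)
  define DE where "DE = v$1 * w$2 - v$2 * w$1"
  define dG where "dG = det (gram g x)"
  define dH where "dH = det (gram g y)"
  have G: "dG * DE\<^sup>2 = 1" unfolding dG_def DE_def by (rule gram_orthonormal[OF A'(2) v1 w(1,2)])
  then have pos: "dG > 0"
    by (metis zero_le_power2 zero_less_mult_iff zero_less_one not_le)
  have "a * c - b\<^sup>2 = dH * (det (matrix B))\<^sup>2 * DE\<^sup>2"
    unfolding a_def b_def c_def bilinear_gram_expand[of g y, OF bl] p_def q_def linear_matrix_entries[OF lin]
      DE_def dH_def det_2 gram_sym[OF A'(2)] by algebra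
  also have "DE\<^sup>2 = 1 / dG" using G pos by (simp add: field_simps)
  finally have "sqrt (a * c - b\<^sup>2) = abs_det A g (f ^^ n) x"
    by (simp add: abs_det_def B_def dG_def dH_def y_def real_sqrt_mult real_sqrt_divide)
  moreover have "(rnorm g y p)\<^sup>2 = a" using a by (simp add: rnorm_def a_def)
  ultimately show ?thesis using 1 by (simp add: y_def B_def p_def)
qed

text \<open>
  The points of an invariant compact set outside all basins again form an invariant compact set,
  as the notion of being far from homotheties presupposes.
\<close>

lemma open_basin:
  assumes S: "attracting_periodic_orbit f S" and f: "continuous_on UNIV f"
  shows "open (basin f S)"
proof -
  from S obtain W where W: "open W" "S \<subseteq> W" "W \<subseteq> basin f S"
    by (auto simp: attracting_periodic_orbit_def asymptotically_stable_def)
  have cont: "continuous_on UNIV (f ^^ k)" for k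
  proof (induction k)
    case (Suc k)
    then show ?case
      using continuous_on_compose[of UNIV "f ^^ k" f] continuous_on_subset[OF f] by simp
  qed (simp add: id_def)
  have "y \<in> basin f S \<longleftrightarrow> (\<exists>k. (f ^^ k) y \<in> W)" for y
  proof
    assume "y \<in> basin f S"
    then have "\<forall>\<^sub>F k in sequentially. (f ^^ k) y \<in> W"
      using W by (simp add: basin_def orbit_converges_to_def)
    then show "\<exists>k. (f ^^ k) y \<in> W" by (auto simp: eventually_sequentially)
  next
    assume "\<exists>k. (f ^^ k) y \<in> W"
    then obtain k where k: "(f ^^ k) y \<in> basin f S" using W by blast
    have "(f ^^ j) ((f ^^ k) y) = (f ^^ (j + k)) y" for j by (simp add: funpow_add)
    then show "y \<in> basin f S"
      using k eventually_sequentially_seg[of "\<lambda>j. (f ^^ j) y \<in> _" k]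
      by (simp only: basin_def orbit_converges_to_def mem_Collect_eq)
  qed
  then have "basin f S = (\<Union>k. (f ^^ k) -` W)" by auto
  moreover have "open ((f ^^ k) -` W)" for k
    using cont[of k] W(1) by (simp add: continuous_on_open_vimage)
  ultimately show ?thesis by auto
qed

lemma outside_basins_compact:
  assumes "continuous_on UNIV f" "compact L"
  shows "compact (outside_basins f L)"
proof -
  have "outside_basins f L = L \<inter> - (\<Union>S\<in>{S. attracting_periodic_orbit f S}. basin f S)"
    by (auto simp: outside_basins_def)
  moreover have "open (\<Union>S\<in>{S. attracting_periodic_orbit f S}. basin f S)"
    using open_basin assms(1) by blast
  ultimately show ?thesis
    using assms(2) compact_Int_closed[of L "- (\<Union>S\<in>{S. attracting_periodic_orbit f S}. basin f S)"]
    by (metis closed_Compl)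
qed

lemma outside_basins_invariant:
  assumes "f ` L = L"
  shows "(f ^^ N) ` outside_basins f L = outside_basins f L"
proof -
  have b: "f x \<in> basin f S \<longleftrightarrow> x \<in> basin f S" for x S
    unfolding basin_def orbit_converges_to_def
    using eventually_sequentially_Suc[of "\<lambda>k. (f ^^ k) x \<in> _"]
    by (simp add: funpow_swap1)
  have "f ` outside_basins f L = outside_basins f L"
  proof (intro equalityI subsetI)
    fix y assume "y \<in> outside_basins f L"
    moreover obtain x where "x \<in> L" "y = f x"
      using assms calculation by (auto simp: outside_basins_def)
    ultimately show "y \<in> f ` outside_basins f L" by (auto simp: outside_basins_def b)
  qed (use assms in \<open>auto simp: outside_basins_def b\<close>)
  then show ?thesis
    by (induction N) (simp_all only: funpow.simps image_comp[symmetric] image_id id_apply)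
qed

end

theory Submission
  imports Defs
begin

text \<open>
  If the conclusion fails, compactness of the unit tangent bundle yields a point \<open>x\<close> of \<open>\<Lambda>'\<close> and a
  direction \<open>v\<close> at \<open>x\<close> such that all projective derivatives of the iterates of \<open>F = f\<^sup>N\<close> at \<open>v\<close> are
  exactly 1. Along the orbit of \<open>v\<close> the tangent map of \<open>F\<close> is then upper triangular with both diagonal
  entries equal to \<open>sqrt |det|\<close> in modulus, so by dissipation the iterates contract all tangent vectors
  exponentially, uniformly along the orbit of \<open>x\<close>. Hence an iterate of \<open>F\<close> contracts balls of a fixed
  radius about the points of this orbit, and a close return produces an attracting periodic orbit
  whose basin contains \<open>x\<close>.
\<close>

section \<open>Local representatives of maps\<close>

text \<open>The distinguished charts may jump with the point, so \<open>tangent_map\<close> and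
  \<open>g\<close> need not vary continuously in the model, and M carries only a topology, no
  distance. All limits and uniform estimates are therefore made with \<open>loc_deriv\<close> and
  \<open>met\<close> in charts kept fixed locally; finitely many compact chart pieces make the
  constants global. The value 1 arises by fixing n and letting delta tend to 0, since (1 - delta)^n
  and (1 + delta)^n both tend to 1. By the cocycle rule every single factor along the orbit is then
  1, so |DF v|^2 = |det| |v|^2: this gives the first diagonal entry, and area gives the second.
  Dissipation enters as |det Df| <= 1/4, hence diagonal entries at most 1/2 in modulus; the
  off-diagonal ones are merely bounded and call for a weighted norm. As f is only C^1, there is no
  distortion control along long orbits. An iterate is taken that contracts strongly enough to absorb
  the changes between metric and coordinates, and uniform continuity of its derivative then yields
  the radius. The orbit of x only has to enter the basin of the sink; x need not be
  periodic.\<close>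

lemma has_derivative_cong_nhds:
  assumes "(\<phi> has_derivative D) (at p)" "\<forall>\<^sub>F q in nhds p. \<phi> q = \<psi> q"
  shows "(\<psi> has_derivative D) (at p)"
proof -
  obtain S where "open S" "p \<in> S" "\<And>q. q \<in> S \<Longrightarrow> \<phi> q = \<psi> q"
    using assms(2) by (auto simp: eventually_nhds)
  then show ?thesis using has_derivative_transform_within_open[OF assms(1)] by blast
qed

lemma Ck_on_1_iff:
  "Ck_on 1 \<phi> S \<longleftrightarrow> (\<forall>p\<in>S. \<phi> differentiable (at p)) \<and>
     (\<forall>v. continuous_on S (\<lambda>p. frechet_derivative \<phi> (at p) v))"
  by simp

lemma linear_basis_expansion:
  assumes "linear (L :: 'a::euclidean_space \<Rightarrow> 'b::real_vector)"
  shows "L v = (\<Sum>b\<in>Basis. (v \<bullet> b) *\<^sub>R L b)"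
  by (metis (no_types, lifting) assms euclidean_representation linear_scale linear_sum sum.cong)

text \<open>\<open>Ck_on 1\<close> gives continuity in the base point for each fixed vector only.
  Expanding the vector in the finite basis turns this into joint continuity in base point and
  vector.\<close>

lemma frechet_derivative_tendsto:
  fixes \<phi> :: "'a::euclidean_space \<Rightarrow> 'b::real_normed_vector"
  assumes C: "Ck_on 1 \<phi> S" and S: "open S" "p \<in> S"
    and P: "(P \<longlongrightarrow> p) F" and u: "(u \<longlongrightarrow> w) F"
  shows "((\<lambda>k. frechet_derivative \<phi> (at (P k)) (u k)) \<longlongrightarrow> frechet_derivative \<phi> (at p) w) F"
proof -
  have lin: "linear (frechet_derivative \<phi> (at q))" if "q \<in> S" for q
    using C that unfolding Ck_on_1_iff by (meson frechet_derivative_works has_derivative_linear)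
  have ev: "\<forall>\<^sub>F k in F. P k \<in> S" using topological_tendstoD[OF P S] .
  have "isCont (\<lambda>q. frechet_derivative \<phi> (at q) b) p" for b
    using C S unfolding Ck_on_1_iff by (simp add: continuous_on_eq_continuous_at)
  then have "((\<lambda>k. frechet_derivative \<phi> (at (P k)) b) \<longlongrightarrow> frechet_derivative \<phi> (at p) b) F" for b
    using isCont_tendsto_compose[OF _ P] by blast
  then have "((\<lambda>k. \<Sum>b\<in>Basis. (u k \<bullet> b) *\<^sub>R frechet_derivative \<phi> (at (P k)) b) \<longlongrightarrow>
      (\<Sum>b\<in>Basis. (w \<bullet> b) *\<^sub>R frechet_derivative \<phi> (at p) b)) F"
    by (intro tendsto_intros u)
  moreover have "\<forall>\<^sub>F k in F. (\<Sum>b\<in>Basis. (u k \<bullet> b) *\<^sub>R frechet_derivative \<phi> (at (P k)) b)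
      = frechet_derivative \<phi> (at (P k)) (u k)"
    using ev by eventually_elim (metis lin linear_basis_expansion)
  ultimately show ?thesis
    using linear_basis_expansion[OF lin[OF S(2)], of w] by (simp add: tendsto_cong)
qed

definition loc_rep :: "'a chart \<Rightarrow> 'a chart \<Rightarrow> ('a \<Rightarrow> 'a) \<Rightarrow> real^2 \<Rightarrow> real^2" where
  "loc_rep c d h = chart_map d \<circ> h \<circ> chart_inv c"

text \<open>Both \<open>tangent_map\<close> and \<open>coord_vector\<close> are instances, for
  distinguished charts and, in the second case, for the identity map. One chain rule thus covers
  compositions and changes of coordinates.\<close>

definition loc_deriv :: "'a chart \<Rightarrow> 'a chart \<Rightarrow> ('a \<Rightarrow> 'a) \<Rightarrow> real^2 \<Rightarrow> real^2 \<Rightarrow> real^2" where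
  "loc_deriv c d h p = frechet_derivative (loc_rep c d h) (at p)"

definition loc_dom :: "'a chart \<Rightarrow> 'a chart \<Rightarrow> ('a \<Rightarrow> 'a) \<Rightarrow> (real^2) set" where
  "loc_dom c d h = chart_map c ` (chart_dom c \<inter> h -` chart_dom d)"

locale surface =
  fixes A :: "'a::t2_space chart set" and g :: "'a metric_tensor"
  assumes surface: "riemannian_surface A g"
begin

lemma atlas: "smooth_atlas A" and metric: "riemannian_metric A g"
  using surface by (auto simp: riemannian_surface_def)

lemma bilinear_metric: "bilinear (g x)" and metric_sym: "g x u v = g x v u" and metric_pos: "v \<noteq> 0 \<Longrightarrow> g x v v > 0"
  using metric by (auto simp: riemannian_metric_def)

lemmas inv_map = chart_inv_chart_map[OF atlas]

lemma chart:
  assumes "c \<in> A"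
  shows "open (chart_dom c)" "open (chart_map c ` chart_dom c)"
    "continuous_on (chart_dom c) (chart_map c)"
    "continuous_on (chart_map c ` chart_dom c) (chart_inv c)"
    "p \<in> chart_map c ` chart_dom c \<Longrightarrow> chart_inv c p \<in> chart_dom c"
    "p \<in> chart_map c ` chart_dom c \<Longrightarrow> chart_map c (chart_inv c p) = p"
  using assms atlas by (auto simp: smooth_atlas_def homeomorphism_def)

lemma chart_image_eq:
  assumes "c \<in> A"
  shows "chart_map c ` (chart_dom c \<inter> U) = chart_map c ` chart_dom c \<inter> chart_inv c -` U"
  using inv_map[OF assms] by force

lemma open_chart_image:
  assumes "c \<in> A" "open U" shows "open (chart_map c ` (chart_dom c \<inter> U))"
  unfolding chart_image_eq[OF assms(1)]
  using chart[OF assms(1)] assms(2) by (metis continuous_on_open_vimage Int_commute)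

lemma open_loc_dom:
  assumes "c \<in> A" "d \<in> A" "continuous_on UNIV h" shows "open (loc_dom c d h)"
  unfolding loc_dom_def using assms
  by (intro open_chart_image) (simp_all add: chart(1) continuous_on_open_vimage)

lemma mem_loc_dom:
  assumes "c \<in> A"
  shows "p \<in> loc_dom c d h \<longleftrightarrow> p \<in> chart_map c ` chart_dom c \<and> h (chart_inv c p) \<in> chart_dom d"
  unfolding loc_dom_def chart_image_eq[OF assms] by auto

lemma C1_loc_rep:
  assumes "C1_map A h" "c \<in> A" "d \<in> A"
  shows "Ck_on 1 (loc_rep c d h) (loc_dom c d h)"
  using assms unfolding C1_map_def loc_rep_def loc_dom_def by blast

lemma loc_rep_derivative:
  assumes "C1_map A h" "c \<in> A" "d \<in> A" "p \<in> loc_dom c d h"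
  shows "(loc_rep c d h has_derivative loc_deriv c d h p) (at p)"
  using C1_loc_rep[OF assms(1-3)] assms(4) unfolding Ck_on_1_iff loc_deriv_def
  by (simp add: frechet_derivative_works)

text \<open>Equality holds only near the point: it needs the image under h to stay in the domain of
  the middle chart, which continuity of h ensures locally.\<close>

lemma loc_rep_comp_eventually:
  assumes h: "continuous_on UNIV h" and A: "c \<in> A" "d \<in> A" and x: "x \<in> chart_dom c" "h x \<in> chart_dom d"
  shows "\<forall>\<^sub>F q in nhds (chart_map c x). (loc_rep d e k \<circ> loc_rep c d h) q = loc_rep c e (k \<circ> h) q"
proof -
  have "open (h -` chart_dom d)" using h chart(1)[OF A(2)] by (simp add: continuous_on_open_vimage)
  then have "\<forall>\<^sub>F q in nhds (chart_map c x). chart_inv c q \<in> h -` chart_dom d"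
    using eventually_chart_inv[OF atlas A(1) x(1), of "h -` chart_dom d"] x(2) by (simp only: vimage_eq)
  then show ?thesis
    by eventually_elim (simp add: loc_rep_def inv_map[OF A(2)])
qed

lemma loc_rep_comp_derivative:
  assumes "continuous_on UNIV h" "c \<in> A" "d \<in> A" "x \<in> chart_dom c" "h x \<in> chart_dom d"
    and "(loc_rep c d h has_derivative D) (at (chart_map c x))"
    and "(loc_rep d e k has_derivative D') (at (chart_map d (h x)))"
  shows "(loc_rep c e (k \<circ> h) has_derivative D' \<circ> D) (at (chart_map c x))"
proof -
  have "loc_rep c d h (chart_map c x) = chart_map d (h x)"
    using inv_map[OF assms(2,4)] by (simp add: loc_rep_def)
  then show ?thesis
    using has_derivative_cong_nhds[OF diff_chain_at loc_rep_comp_eventually[OF assms(1-5)]] assms(6,7)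
    by simp
qed

text \<open>This is the smoothness of the transition maps; it makes a change of charts a case of the
  chain rule.\<close>

lemma C1_id: "C1_map A id"
proof -
  have "Ck_on 1 (chart_map d \<circ> id \<circ> chart_inv c) (chart_map c ` (chart_dom c \<inter> id -` chart_dom d))"
    if "c \<in> A" "d \<in> A" for c d
  proof -
    have "smooth_on (chart_map c ` (chart_dom c \<inter> chart_dom d)) (chart_map d \<circ> chart_inv c)"
      using atlas that by (simp add: smooth_atlas_def)
    then have "Ck_on 1 (chart_map d \<circ> chart_inv c) (chart_map c ` (chart_dom c \<inter> chart_dom d))"
      unfolding smooth_on_def by blast
    then show ?thesis by simp
  qed
  then show ?thesis unfolding C1_map_def by (auto intro: continuous_on_id simp: id_def)
qed

lemma loc_deriv_comp:
  assumes "C1_map A h" "C1_map A k" "c \<in> A" "d \<in> A" "e \<in> A"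
    and "x \<in> chart_dom c" "h x \<in> chart_dom d" "k (h x) \<in> chart_dom e"
  shows "(loc_rep c e (k \<circ> h) has_derivative
           loc_deriv d e k (chart_map d (h x)) \<circ> loc_deriv c d h (chart_map c x)) (at (chart_map c x))"
    and "loc_deriv c e (k \<circ> h) (chart_map c x)
      = loc_deriv d e k (chart_map d (h x)) \<circ> loc_deriv c d h (chart_map c x)"
proof -
  have "chart_map c x \<in> loc_dom c d h" "chart_map d (h x) \<in> loc_dom d e k"
    using assms inv_map by (auto simp: mem_loc_dom)
  then have "(loc_rep c d h has_derivative loc_deriv c d h (chart_map c x)) (at (chart_map c x))"
    "(loc_rep d e k has_derivative loc_deriv d e k (chart_map d (h x))) (at (chart_map d (h x)))"
    using loc_rep_derivative assms by blast+
  moreover have "continuous_on UNIV h" using assms(1) by (simp add: C1_map_def)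
  ultimately show 1: "(loc_rep c e (k \<circ> h) has_derivative
           loc_deriv d e k (chart_map d (h x)) \<circ> loc_deriv c d h (chart_map c x)) (at (chart_map c x))"
    using loc_rep_comp_derivative assms by blast
  show "loc_deriv c e (k \<circ> h) (chart_map c x)
      = loc_deriv d e k (chart_map d (h x)) \<circ> loc_deriv c d h (chart_map c x)"
    using frechet_derivative_at[OF 1] unfolding loc_deriv_def by simp
qed

lemma loc_rep_isCont:
  assumes "continuous_on UNIV h" "c \<in> A" "d \<in> A" "p \<in> loc_dom c d h"
  shows "isCont (loc_rep c d h) p"
proof -
  have *: "p \<in> chart_map c ` chart_dom c" "h (chart_inv c p) \<in> chart_dom d"
    using assms(2,4) mem_loc_dom by blast+
  have "isCont (chart_inv c) p" using chart(2,4)[OF assms(2)] * by (metis continuous_on_eq_continuous_at)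
  moreover have "isCont h (chart_inv c p)" using assms(1) by (simp add: continuous_on_eq_continuous_at)
  moreover have "isCont (chart_map d) (h (chart_inv c p))"
    using chart(1,3)[OF assms(3)] * by (simp add: continuous_on_eq_continuous_at)
  ultimately show ?thesis unfolding loc_rep_def o_def
    using isCont_o2[of p "chart_inv c" h] isCont_o2[of p "\<lambda>p. h (chart_inv c p)" "chart_map d"] by blast
qed

text \<open>No single middle chart serves all of \<open>loc_dom c e (k \<circ> h)\<close>. Near each
  point p the distinguished chart at the image of p is used, and the chain rule holds on the whole
  neighbourhood \<open>O1\<close>, so that continuity of the derivative at p can be read off from
  it.\<close>

lemma C1_comp:
  assumes h: "C1_map A h" and k: "C1_map A k"
  shows "C1_map A (k \<circ> h)"
proof -
  have ch: "continuous_on UNIV h" and ck: "continuous_on UNIV k" using h k by (auto simp: C1_map_def)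
  have ckh: "continuous_on UNIV (k \<circ> h)"
    using ch ck continuous_on_subset[of UNIV k "range h"] by (intro continuous_on_compose) auto
  have "Ck_on 1 (loc_rep c e (k \<circ> h)) (loc_dom c e (k \<circ> h))" if A: "c \<in> A" "e \<in> A" for c e
  proof -
    note o = open_loc_dom[OF A ckh]
    have key: "loc_rep c e (k \<circ> h) differentiable at p"
      "isCont (\<lambda>q. frechet_derivative (loc_rep c e (k \<circ> h)) (at q) v) p"
      if p: "p \<in> loc_dom c e (k \<circ> h)" for p v
    proof -
      define x where "x = chart_inv c p"
      define d where "d = chart_at A (h x)"
      have d: "d \<in> A" "h x \<in> chart_dom d" using chart_at[OF atlas] by (auto simp: d_def)
      have p': "p \<in> chart_map c ` chart_dom c" using p A(1) mem_loc_dom by blast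
      have x: "x \<in> chart_dom c" "chart_map c x = p" "k (h x) \<in> chart_dom e"
        using p p' A(1) chart(5,6)[OF A(1)] mem_loc_dom[OF A(1)] by (simp_all add: x_def)
      have pd: "p \<in> loc_dom c d h" using A p' d by (simp add: mem_loc_dom x_def)
      have dd: "chart_map d (h x) \<in> loc_dom d e k" using d x inv_map[OF d] by (auto simp: mem_loc_dom)
      have D: "(loc_rep c e (k \<circ> h) has_derivative
          loc_deriv d e k (chart_map d (h (chart_inv c q))) \<circ> loc_deriv c d h q) (at q)"
        if "q \<in> loc_dom c e (k \<circ> h) \<inter> loc_dom c d h" for q
        using loc_deriv_comp(1)[OF h k A(1) d(1) A(2), of "chart_inv c q"] that A(1) chart(5,6)[OF A(1)]
        by (simp add: mem_loc_dom)
      show "loc_rep c e (k \<circ> h) differentiable at p" using D p pd differentiableI by blast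
      define O1 where "O1 = loc_dom c e (k \<circ> h) \<inter> loc_dom c d h"
      have O1: "open O1" "p \<in> O1" using o open_loc_dom[OF A(1) d(1) ch] p pd by (auto simp: O1_def)
      have lim: "((\<lambda>q. frechet_derivative (loc_rep d e k) (at (loc_rep c d h q)) (loc_deriv c d h q v)) \<longlongrightarrow>
          frechet_derivative (loc_rep d e k) (at (loc_rep c d h p)) (loc_deriv c d h p v)) (at p)"
      proof (rule frechet_derivative_tendsto[OF C1_loc_rep[OF k d(1) A(2)] open_loc_dom[OF d(1) A(2) ck]])
        show "loc_rep c d h p \<in> loc_dom d e k" using dd by (simp add: loc_rep_def x_def)
        show "(loc_rep c d h \<longlongrightarrow> loc_rep c d h p) (at p)"
          using loc_rep_isCont[OF ch A(1) d(1) pd] by (simp add: isCont_def)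
        show "((\<lambda>q. loc_deriv c d h q v) \<longlongrightarrow> loc_deriv c d h p v) (at p)"
          unfolding loc_deriv_def
          by (rule frechet_derivative_tendsto[OF C1_loc_rep[OF h A(1) d(1)] open_loc_dom[OF A(1) d(1) ch] pd])
            (auto intro: tendsto_intros)
      qed
      have eq: "frechet_derivative (loc_rep d e k) (at (loc_rep c d h q)) (loc_deriv c d h q v)
          = frechet_derivative (loc_rep c e (k \<circ> h)) (at q) v" if "q \<in> O1" for q
        using fun_cong[OF frechet_derivative_at[OF D[OF that[unfolded O1_def]]], of v]
        by (simp add: loc_deriv_def loc_rep_def)
      have "\<forall>\<^sub>F q in at p. q \<in> O1"
        using eventually_nhds_in_open[OF O1] by (simp add: eventually_at_filter eventually_mono)
      then have "\<forall>\<^sub>F q in at p. frechet_derivative (loc_rep d e k) (at (loc_rep c d h q)) (loc_deriv c d h q v)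
          = frechet_derivative (loc_rep c e (k \<circ> h)) (at q) v"
        by (rule eventually_mono) (rule eq)
      from Lim_transform_eventually[OF lim this]
      have "((\<lambda>q. frechet_derivative (loc_rep c e (k \<circ> h)) (at q) v) \<longlongrightarrow>
          frechet_derivative (loc_rep c e (k \<circ> h)) (at p) v) (at p)"
        unfolding eq[OF O1(2)] .
      then show "isCont (\<lambda>q. frechet_derivative (loc_rep c e (k \<circ> h)) (at q) v) p"
        by (simp add: isCont_def)
    qed
    then show ?thesis unfolding Ck_on_1_iff using o by (simp add: continuous_on_eq_continuous_at)
  qed
  then show ?thesis using ckh unfolding C1_map_def loc_rep_def loc_dom_def by blast
qed

lemma C1_funpow: "C1_map A h \<Longrightarrow> C1_map A (h ^^ n)"
  by (induction n) (auto simp: C1_id[unfolded id_def] id_def intro: C1_comp[of "h ^^ n" h for n])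

lemma C1_diffeo_funpow:
  assumes "C1_diffeo A h" shows "C1_diffeo A (h ^^ n)"
proof -
  have h: "bij h" "C1_map A h" "C1_map A (inv h)" using assms by (auto simp: C1_diffeo_def)
  have "inv (h ^^ n) = inv h ^^ n" using inv_fn[OF h(1)] .
  then show ?thesis using h C1_funpow bij_betw_funpow unfolding C1_diffeo_def by metis
qed

section \<open>Tangent vectors and the metric in charts\<close>

lemma coord_vector_eq: "coord_vector A c x = loc_deriv c (chart_at A x) id (chart_map c x)"
  by (simp add: coord_vector_def loc_deriv_def loc_rep_def)

lemma tangent_map_eq: "tangent_map A h x = loc_deriv (chart_at A x) (chart_at A (h x)) h (chart_map (chart_at A x) x)"
  by (simp add: tangent_map_def loc_deriv_def loc_rep_def)

text \<open>Both sides are the derivative of h from the chart c to the distinguished chart at h x,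
  with the identity composed before h or after it. This moves every statement about
  \<open>tangent_map\<close> into freely chosen charts.\<close>

lemma tangent_map_coord_vector:
  assumes h: "C1_map A h" and A: "c \<in> A" "d \<in> A" and x: "x \<in> chart_dom c" "h x \<in> chart_dom d"
  shows "tangent_map A h x (coord_vector A c x u)
    = coord_vector A d (h x) (loc_deriv c d h (chart_map c x) u)"
proof -
  note a = chart_at[OF atlas, of x] and b = chart_at[OF atlas, of "h x"]
  have "tangent_map A h x \<circ> coord_vector A c x = loc_deriv c (chart_at A (h x)) (h \<circ> id) (chart_map c x)"
    using loc_deriv_comp(2)[OF C1_id h A(1) a(1) b(1)] x a b
    by (simp add: tangent_map_eq coord_vector_eq)
  also have "\<dots> = coord_vector A d (h x) \<circ> loc_deriv c d h (chart_map c x)"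
    using loc_deriv_comp(2)[OF h C1_id A b(1)] x a b
    by (simp add: coord_vector_eq)
  finally show ?thesis by (metis comp_apply)
qed

lemma linear_loc_deriv:
  assumes "C1_map A h" "c \<in> A" "d \<in> A" "p \<in> loc_dom c d h"
  shows "linear (loc_deriv c d h p)"
  using loc_rep_derivative[OF assms] has_derivative_linear by blast

lemma linear_coord_vector:
  assumes "c \<in> A" "x \<in> chart_dom c" shows "linear (coord_vector A c x)"
  unfolding coord_vector_eq using assms chart_at[OF atlas, of x] inv_map[OF assms]
  by (intro linear_loc_deriv C1_id) (auto simp: mem_loc_dom)

text \<open>The chain rule for the identity composed with itself provides a left inverse; a linear
  injection of the plane is onto.\<close>

lemma coord_vector_bij:
  assumes c: "c \<in> A" "x \<in> chart_dom c" shows "bij (coord_vector A c x)"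
proof -
  note a = chart_at[OF atlas, of x]
  have "loc_deriv c c (id \<circ> id) (chart_map c x) = loc_deriv (chart_at A x) c id (chart_map (chart_at A x) x) \<circ> coord_vector A c x"
    using loc_deriv_comp(2)[OF C1_id C1_id c(1) a(1) c(1)] c a by (simp add: coord_vector_eq)
  moreover have "loc_deriv c c id (chart_map c x) = id"
  proof -
    have "(id has_derivative id) (at (chart_map c x))" using has_derivative_id by (simp add: id_def)
    moreover have "\<forall>\<^sub>F q in nhds (chart_map c x). id q = loc_rep c c id q"
      by (rule eventually_mono[OF eventually_nhds_in_open[OF chart(2)[OF c(1)] imageI[OF c(2)]]])
        (simp add: loc_rep_def chart(6)[OF c(1)])
    ultimately have "(loc_rep c c id has_derivative id) (at (chart_map c x))"
      by (rule has_derivative_cong_nhds)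
    then show ?thesis unfolding loc_deriv_def by (rule frechet_derivative_at[symmetric])
  qed
  ultimately have "inj (coord_vector A c x)" by (metis comp_id inj_on_id inj_on_imageI2)
  then show ?thesis
    using linear_injective_imp_surjective[OF linear_coord_vector[OF c]] by (simp add: bij_def)
qed

text \<open>The metric coefficients in the chart c, in the form in which
  \<open>riemannian_metric\<close> asks for smoothness; unlike \<open>g\<close> itself they are
  continuous in the base point.\<close>

definition met :: "'a chart \<Rightarrow> real^2 \<Rightarrow> real^2 \<Rightarrow> real^2 \<Rightarrow> real" where
  "met c p u w = g (chart_inv c p) (coord_vector A c (chart_inv c p) u) (coord_vector A c (chart_inv c p) w)"

lemma met_chart_map:
  assumes "c \<in> A" "x \<in> chart_dom c"
  shows "met c (chart_map c x) u w = g x (coord_vector A c x u) (coord_vector A c x w)"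
  using inv_map[OF assms] by (simp add: met_def)

lemma bilinear_met:
  assumes "c \<in> A" "p \<in> chart_map c ` chart_dom c" shows "bilinear (met c p)"
proof -
  have l: "linear (coord_vector A c (chart_inv c p))"
    using linear_coord_vector assms chart(5) by blast
  show ?thesis
    unfolding bilinear_def met_def
    using linear_compose[OF l, of "g (chart_inv c p) _"] linear_compose[OF l, of "\<lambda>u. g (chart_inv c p) u _"]
      bilinear_metric[of "chart_inv c p"] by (simp add: bilinear_def o_def)
qed

lemma met_pos:
  assumes "c \<in> A" "p \<in> chart_map c ` chart_dom c" "u \<noteq> 0" shows "met c p u u > 0"
proof -
  have x: "chart_inv c p \<in> chart_dom c" using chart(5) assms by blast
  have "coord_vector A c (chart_inv c p) u \<noteq> 0"
    using assms(3) coord_vector_bij[OF assms(1) x] linear_0[OF linear_coord_vector[OF assms(1) x]]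
    by (metis bij_is_inj injD)
  then show ?thesis using metric_pos by (simp add: met_def)
qed

lemma met_expansion:
  assumes "c \<in> A" "p \<in> chart_map c ` chart_dom c"
  shows "met c p u w = (\<Sum>a\<in>Basis. \<Sum>b\<in>Basis. (u \<bullet> a) * ((w \<bullet> b) * met c p a b))"
proof -
  have l: "linear (\<lambda>u. met c p u w)" "\<And>u. linear (met c p u)"
    using bilinear_met[OF assms] by (simp_all add: bilinear_def)
  show ?thesis
    unfolding linear_basis_expansion[OF l(1), of u]
    by (subst linear_basis_expansion[OF l(2)]) (simp add: sum_distrib_left)
qed

lemma met_tendsto:
  assumes c: "c \<in> A" "p \<in> chart_map c ` chart_dom c"
    and P: "(P \<longlongrightarrow> p) F" and u: "(u \<longlongrightarrow> u0) F" and w: "(w \<longlongrightarrow> w0) F"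
  shows "((\<lambda>k. met c (P k) (u k) (w k)) \<longlongrightarrow> met c p u0 w0) F"
proof -
  have "continuous_on (chart_map c ` chart_dom c) (\<lambda>p. met c p a b)" for a b
  proof -
    have "smooth_on (chart_map c ` chart_dom c) (\<lambda>p. met c p a b)"
      using metric c(1) unfolding riemannian_metric_def met_def by blast
    then have "Ck_on 0 (\<lambda>p. met c p a b) (chart_map c ` chart_dom c)"
      unfolding smooth_on_def by blast
    then show ?thesis by simp
  qed
  then have "isCont (\<lambda>p. met c p a b) p" for a b
    using chart(2)[OF c(1)] c(2) by (metis continuous_on_eq_continuous_at)
  then have ab: "((\<lambda>k. met c (P k) a b) \<longlongrightarrow> met c p a b) F" for a b
    using isCont_tendsto_compose[OF _ P] by blast
  have "((\<lambda>k. \<Sum>a\<in>Basis. \<Sum>b\<in>Basis. (u k \<bullet> a) * ((w k \<bullet> b) * met c (P k) a b)) \<longlongrightarrow> met c p u0 w0) F"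
    unfolding met_expansion[OF c, of u0 w0] by (intro tendsto_intros u w ab)
  moreover have "\<forall>\<^sub>F k in F. P k \<in> chart_map c ` chart_dom c"
    using topological_tendstoD[OF P chart(2)[OF c(1)] c(2)] .
  then have "\<forall>\<^sub>F k in F. (\<Sum>a\<in>Basis. \<Sum>b\<in>Basis. (u k \<bullet> a) * ((w k \<bullet> b) * met c (P k) a b)) = met c (P k) (u k) (w k)"
    by eventually_elim (use met_expansion[OF c(1)] in simp)
  ultimately show ?thesis by (simp add: tendsto_cong)
qed

lemma rnorm_sq: "(rnorm g x v)\<^sup>2 = g x v v"
  using metric_pos[of v x] bilinear_lzero[OF bilinear_metric] by (cases "v = 0") (auto simp: rnorm_def)

lemma rnorm_scale: "rnorm g x (a *\<^sub>R v) = \<bar>a\<bar> * rnorm g x v"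
  by (simp add: rnorm_def bilinear_lmul[OF bilinear_metric] bilinear_rmul[OF bilinear_metric] real_sqrt_mult mult.assoc[symmetric])

lemma rnorm_pos: "v \<noteq> 0 \<Longrightarrow> rnorm g x v > 0"
  using metric_pos by (simp add: rnorm_def)

lemma rnorm_nonneg: "rnorm g x v \<ge> 0"
  using rnorm_pos[of v x] bilinear_lzero[OF bilinear_metric] by (cases "v = 0") (auto simp: rnorm_def)

section \<open>Area distortion and the projective derivative\<close>

text \<open>The Gram determinant: the squared area of the parallelogram spanned by u and w. Its
  nonnegativity is the Cauchy-Schwarz inequality.\<close>

definition area_sq :: "'a \<Rightarrow> real^2 \<Rightarrow> real^2 \<Rightarrow> real" where
  "area_sq x u w = g x u u * g x w w - (g x u w)\<^sup>2"

lemma area_sq_eq: "area_sq x u w = det (gram g x) * (u$1 * w$2 - u$2 * w$1)\<^sup>2"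
proof -
  note ex = bilinear_gram_expand[of g x, OF bilinear_metric]
  show ?thesis
    unfolding area_sq_def ex[of u u] ex[of w w] ex[of u w] det_2 gram_sym[OF metric] by algebra
qed

lemma unit_tangent_exists: "\<exists>v. v \<in> unit_tangent g x"
proof -
  have "axis 1 1 /\<^sub>R rnorm g x (axis 1 1) \<in> unit_tangent g x"
    using rnorm_pos[of "axis 1 1" x] by (simp add: unit_tangent_def rnorm_scale axis_eq_0_iff)
  then show ?thesis by blast
qed

lemma det_gram_pos: "det (gram g x) > 0"
proof -
  obtain v where v: "v \<in> unit_tangent g x" using unit_tangent_exists by blast
  note w = unit_normal_exists[OF metric v]
  have "det (gram g x) * (v$1 * unit_normal g x v$2 - v$2 * unit_normal g x v$1)^2 = 1"
    by (rule gram_orthonormal[OF metric]) (use v w in \<open>auto simp: unit_tangent_def rnorm_def\<close>)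
  then show ?thesis
    by (metis mult_nonpos_nonneg not_less zero_le_power2 zero_less_one)
qed

lemma area_sq_nonneg: "area_sq x u w \<ge> 0"
  using det_gram_pos[of x] by (simp add: area_sq_eq)

lemma linear_tangent_map: "C1_map A h \<Longrightarrow> linear (tangent_map A h x)"
  using tangent_map_has_derivative[OF atlas] has_derivative_linear by blast

lemma abs_det_nonneg: "abs_det A g h x \<ge> 0"
  using det_gram_pos by (simp add: abs_det_def less_imp_le)

text \<open>Identifies \<open>abs_det\<close> as the factor by which areas are distorted, which
  allows it to be computed from any pair of independent vectors in any charts.\<close>

lemma area_sq_tangent_map:
  assumes "C1_map A h"
  shows "area_sq (h x) (tangent_map A h x u) (tangent_map A h x w) = (abs_det A g h x)\<^sup>2 * area_sq x u w"
proof -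
  note e = linear_matrix_entries[OF linear_tangent_map[OF assms, of x]]
  have "tangent_map A h x u$1 * tangent_map A h x w$2 - tangent_map A h x u$2 * tangent_map A h x w$1
    = det (matrix (tangent_map A h x)) * (u$1 * w$2 - u$2 * w$1)"
    unfolding e det_2 by algebra
  then show ?thesis
    using det_gram_pos[of x] det_gram_pos[of "h x"]
    by (simp add: area_sq_eq abs_det_def power_mult_distrib power_divide)
qed

lemma area_sq_coord_vector:
  assumes "c \<in> A" "x \<in> chart_dom c"
  shows "area_sq x (coord_vector A c x u) (coord_vector A c x w)
    = met c (chart_map c x) u u * met c (chart_map c x) w w - (met c (chart_map c x) u w)\<^sup>2"
  by (simp add: area_sq_def met_chart_map[OF assms])

lemma area_sq_eq_0:
  assumes "area_sq x u w = 0" "u \<noteq> 0" shows "\<exists>t. w = t *\<^sub>R u"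
proof -
  have 0: "u$1 * w$2 = u$2 * w$1" using assms(1) det_gram_pos[of x] by (auto simp: area_sq_eq)
  have "u$1 \<noteq> 0 \<or> u$2 \<noteq> 0" using assms(2) by (auto simp: vec_eq_iff forall_2)
  then show ?thesis
  proof
    assume "u$1 \<noteq> 0"
    then have "w = (w$1 / u$1) *\<^sub>R u" using 0 by (simp add: vec_eq_iff forall_2 field_simps)
    then show ?thesis ..
  next
    assume "u$2 \<noteq> 0"
    then have "w = (w$2 / u$2) *\<^sub>R u" using 0 by (simp add: vec_eq_iff forall_2 field_simps)
    then show ?thesis ..
  qed
qed

lemma tangent_map_comp':
  assumes "C1_map A h" "C1_map A k"
  shows "tangent_map A (k \<circ> h) x = tangent_map A k (h x) \<circ> tangent_map A h x"
  using assms by (intro tangent_map_comp(2)[OF atlas _ tangent_map_has_derivative[OF atlas]])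
    (auto simp: C1_map_def)

lemma abs_det_comp:
  assumes "C1_map A h" "C1_map A k"
  shows "abs_det A g (k \<circ> h) x = abs_det A g k (h x) * abs_det A g h x"
  using det_gram_pos[of "h x"] det_gram_pos[of x]
  by (simp add: abs_det_def tangent_map_comp'[OF assms] matrix_compose linear_tangent_map assms
      det_mul abs_mult)

text \<open>The closed formula for the projective derivative, extended from unit vectors to all
  nonzero vectors so as to be invariant under scaling. This avoids normalising along orbits, and the
  cocycle rule becomes a plain product.\<close>

definition expan :: "('a \<Rightarrow> 'a) \<Rightarrow> 'a \<Rightarrow> real^2 \<Rightarrow> real" where
  "expan h x v = abs_det A g h x * g x v v / g (h x) (tangent_map A h x v) (tangent_map A h x v)"

lemma projective_deriv_expan:
  assumes "C1_diffeo A h" "v \<in> unit_tangent g x"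
  shows "projective_deriv A g h n x v = expan (h ^^ n) x v"
proof -
  have "g x v v = 1" using assms(2) by (simp add: unit_tangent_def rnorm_def)
  then show ?thesis using projective_deriv_eq[OF surface assms] by (simp add: expan_def rnorm_sq)
qed

lemma expan_comp:
  assumes h: "C1_diffeo A h" and k: "C1_diffeo A k" and "v \<noteq> 0"
  shows "expan (k \<circ> h) x v = expan k (h x) (tangent_map A h x v) * expan h x v"
proof -
  have C: "C1_map A h" "C1_map A k" using h k by (auto simp: C1_diffeo_def)
  have "g (h x) (tangent_map A h x v) (tangent_map A h x v) \<noteq> 0"
    using metric_pos tangent_map_nonzero[OF atlas h \<open>v \<noteq> 0\<close>] by (metis less_irrefl)
  then show ?thesis by (simp add: expan_def tangent_map_comp'[OF C] abs_det_comp[OF C])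
qed

lemma expan_scale:
  assumes "C1_map A h" "a \<noteq> 0" shows "expan h x (a *\<^sub>R v) = expan h x v"
  using assms linear_tangent_map[OF assms(1), of x]
  by (simp add: expan_def linear_cmul bilinear_lmul[OF bilinear_metric] bilinear_rmul[OF bilinear_metric])

text \<open>Neither \<open>abs_det\<close> nor \<open>tangent_map\<close> is visibly continuous.
  With d fixed as a chart around the image of the limit point, \<open>expan\<close> is rewritten
  near p through \<open>met\<close> and \<open>loc_deriv\<close>, which are.\<close>

lemma expan_tendsto:
  assumes h: "C1_diffeo A h" and c: "c \<in> A" "p \<in> chart_map c ` chart_dom c"
    and P: "(P \<longlongrightarrow> p) F" and u: "(u \<longlongrightarrow> w) F" and w: "w \<noteq> 0"
  shows "((\<lambda>k. expan h (chart_inv c (P k)) (coord_vector A c (chart_inv c (P k)) (u k)))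
    \<longlongrightarrow> expan h (chart_inv c p) (coord_vector A c (chart_inv c p) w)) F"
proof -
  have C: "C1_map A h" "continuous_on UNIV h" using h by (auto simp: C1_diffeo_def C1_map_def)
  define d where "d = chart_at A (h (chart_inv c p))"
  have d: "d \<in> A" "h (chart_inv c p) \<in> chart_dom d" using chart_at[OF atlas] by (auto simp: d_def)
  have p: "p \<in> loc_dom c d h" using c d by (simp add: mem_loc_dom)
  note o = open_loc_dom[OF c(1) d(1) C(2)]
  define D where "D = loc_deriv c d h"
  define \<phi> where "\<phi> = loc_rep c d h"
  define ar where "ar = (\<lambda>e p u w. met e p u u * met e p w w - (met e p u w)\<^sup>2)"
  define e1 e2 where "e1 = (axis 1 1 :: real^2)" and "e2 = (axis 2 1 :: real^2)"
  \<comment> \<open>\<open>ar\<close> is \<open>area_sq\<close> in coordinates, so the root of the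
    quotient of squared areas for the coordinate basis is \<open>abs_det\<close>.\<close>
  define X where "X = (\<lambda>q u. sqrt (ar d (\<phi> q) (D q e1) (D q e2) / ar c q e1 e2) * met c q u u
     / met d (\<phi> q) (D q u) (D q u))"
  have cvd: "h (chart_inv c q) \<in> chart_dom d" "chart_inv c q \<in> chart_dom c" "chart_map c (chart_inv c q) = q"
    "\<phi> q \<in> chart_map d ` chart_dom d" "q \<in> chart_map c ` chart_dom c"
    if "q \<in> loc_dom c d h" for q
    using that mem_loc_dom[OF c(1)] chart(5,6)[OF c(1)] by (auto simp: \<phi>_def loc_rep_def)
  have T: "tangent_map A h (chart_inv c q) (coord_vector A c (chart_inv c q) z)
      = coord_vector A d (h (chart_inv c q)) (D q z)" if "q \<in> loc_dom c d h" for q z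
    using tangent_map_coord_vector[OF C(1) c(1) d(1) cvd(2,1)[OF that]] cvd(3)[OF that] by (simp add: D_def)
  have \<phi>: "\<phi> q = chart_map d (h (chart_inv c q))" for q by (simp add: \<phi>_def loc_rep_def)
  \<comment> \<open>The denominator does not vanish: zero area would make the images of e1 and e2
    proportional, against injectivity of \<open>coord_vector\<close>.\<close>
  have arc: "ar c q e1 e2 > 0" if q: "q \<in> loc_dom c d h" for q
  proof -
    note x = cvd(2)[OF q]
    have "area_sq (chart_inv c q) (coord_vector A c (chart_inv c q) e1) (coord_vector A c (chart_inv c q) e2) \<noteq> 0"
    proof
      assume *: "area_sq (chart_inv c q) (coord_vector A c (chart_inv c q) e1) (coord_vector A c (chart_inv c q) e2) = 0"
      have l: "linear (coord_vector A c (chart_inv c q))" using linear_coord_vector[OF c(1) x] .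
      have i: "inj (coord_vector A c (chart_inv c q))" using coord_vector_bij[OF c(1) x] bij_is_inj by blast
      have "coord_vector A c (chart_inv c q) e1 \<noteq> 0"
        using i linear_0[OF l] by (metis injD e1_def axis_eq_0_iff zero_neq_one)
      then obtain t where "coord_vector A c (chart_inv c q) e2 = t *\<^sub>R coord_vector A c (chart_inv c q) e1"
        using area_sq_eq_0[OF *] by blast
      then have "e2 = t *\<^sub>R e1" using i by (metis injD linear_cmul[OF l])
      then have "e2 $ 2 = t * e1 $ 2" by simp
      then show False by (simp add: e1_def e2_def axis_def)
    qed
    then show ?thesis
      using area_sq_coord_vector[OF c(1) x, of e1 e2] cvd(3)[OF q]
        area_sq_nonneg[of "chart_inv c q" "coord_vector A c (chart_inv c q) e1" "coord_vector A c (chart_inv c q) e2"]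
      unfolding ar_def cvd(3)[OF q] by linarith
  qed
  have eq: "expan h (chart_inv c q) (coord_vector A c (chart_inv c q) z) = X q z"
    if q: "q \<in> loc_dom c d h" for q z
  proof -
    have "ar d (\<phi> q) (D q e1) (D q e2) = (abs_det A g h (chart_inv c q))\<^sup>2 * ar c q e1 e2"
      using area_sq_tangent_map[OF C(1), of "chart_inv c q" "coord_vector A c (chart_inv c q) e1" "coord_vector A c (chart_inv c q) e2"]
      unfolding T[OF q] area_sq_coord_vector[OF d(1) cvd(1)[OF q]] area_sq_coord_vector[OF c(1) cvd(2)[OF q]]
      by (simp add: ar_def cvd(3)[OF q] \<phi>)
    then have "abs_det A g h (chart_inv c q) = sqrt (ar d (\<phi> q) (D q e1) (D q e2) / ar c q e1 e2)"
      using arc[OF q] abs_det_nonneg by simp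
    then show ?thesis
      unfolding expan_def X_def T[OF q] by (simp add: met_def \<phi> chart(6)[OF d(1)] inv_map[OF d(1)] cvd[OF q])
  qed
  have \<phi>P: "((\<lambda>k. \<phi> (P k)) \<longlongrightarrow> \<phi> p) F"
    unfolding \<phi>_def using isCont_tendsto_compose[OF loc_rep_isCont[OF C(2) c(1) d(1) p] P] .
  have DP: "((\<lambda>k. D (P k) (z k)) \<longlongrightarrow> D p y) F" if "(z \<longlongrightarrow> y) F" for z y
    unfolding D_def loc_deriv_def
    using frechet_derivative_tendsto[OF C1_loc_rep[OF C(1) c(1) d(1)] o p P that] .
  have mc: "((\<lambda>k. met c (P k) (y k) (z k)) \<longlongrightarrow> met c p y0 z0) F" if "(y \<longlongrightarrow> y0) F" "(z \<longlongrightarrow> z0) F" for y z y0 z0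
    using met_tendsto[OF c P that] .
  have md: "((\<lambda>k. met d (\<phi> (P k)) (D (P k) (y k)) (D (P k) (z k))) \<longlongrightarrow> met d (\<phi> p) (D p y0) (D p z0)) F"
    if "(y \<longlongrightarrow> y0) F" "(z \<longlongrightarrow> z0) F" for y z y0 z0
    using met_tendsto[OF d(1) cvd(4)[OF p] \<phi>P DP[OF that(1)] DP[OF that(2)]] .
  have nz: "met d (\<phi> p) (D p w) (D p w) \<noteq> 0"
  proof -
    have "coord_vector A c (chart_inv c p) w \<noteq> 0"
      using met_pos[OF c w] bilinear_lzero[OF bilinear_metric] by (auto simp: met_def)
    then have "coord_vector A d (h (chart_inv c p)) (D p w) \<noteq> 0"
      unfolding T[OF p, symmetric] by (rule tangent_map_nonzero[OF atlas h])
    then have "D p w \<noteq> 0" using linear_0[OF linear_coord_vector[OF d]] by metis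
    then show ?thesis using met_pos[OF d(1) cvd(4)[OF p]] by force
  qed
  have "((\<lambda>k. X (P k) (u k)) \<longlongrightarrow> X p w) F"
    unfolding X_def ar_def
    by (intro tendsto_intros mc md u) (use arc[OF p] nz in \<open>auto simp: ar_def\<close>)
  moreover have "\<forall>\<^sub>F k in F. P k \<in> loc_dom c d h" using topological_tendstoD[OF P o p] .
  then have "\<forall>\<^sub>F k in F. X (P k) (u k) = expan h (chart_inv c (P k)) (coord_vector A c (chart_inv c (P k)) (u k))"
    by eventually_elim (simp add: eq)
  ultimately show ?thesis unfolding eq[OF p] by (simp add: tendsto_cong)
qed

section \<open>Finitely many compact chart pieces\<close>

text \<open>A chart together with a compact set of coordinates inside its image: estimates are
  uniform on the compact part, while they may degenerate towards the edge of the chart.\<close>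

definition piece :: "'a chart \<times> (real^2) set \<Rightarrow> bool" where
  "piece i \<longleftrightarrow> fst i \<in> A \<and> compact (snd i) \<and> snd i \<subseteq> chart_map (fst i) ` chart_dom (fst i)"

definition in_piece :: "'a chart \<times> (real^2) set \<Rightarrow> 'a \<Rightarrow> bool" where
  "in_piece i x \<longleftrightarrow> x \<in> chart_dom (fst i) \<and> chart_map (fst i) x \<in> snd i"

lemma finite_pieces:
  assumes "compact (UNIV :: 'a set)"
  obtains I where "finite I" "\<And>i. i \<in> I \<Longrightarrow> piece i" "\<And>x. \<exists>i\<in>I. in_piece i x"
proof -
  define c where "c = chart_at A"
  have c: "c x \<in> A" "x \<in> chart_dom (c x)" for x using chart_at[OF atlas] by (auto simp: c_def)
  have "\<exists>e>0. cball (chart_map (c x) x) e \<subseteq> chart_map (c x) ` chart_dom (c x)" for x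
    using open_contains_cball chart(2)[OF c(1)] c(2) by (metis imageI)
  then obtain e where e: "\<And>x. e x > 0" "\<And>x. cball (chart_map (c x) x) (e x) \<subseteq> chart_map (c x) ` chart_dom (c x)"
    by metis
  define U where "U x = chart_dom (c x) \<inter> chart_map (c x) -` ball (chart_map (c x) x) (e x)" for x
  have "open (U x)" for x
    unfolding U_def using chart(1,3)[OF c(1)] by (metis Int_commute continuous_on_open_vimage open_ball)
  moreover have "x \<in> U x" for x using c e by (simp add: U_def)
  ultimately have "UNIV \<subseteq> (\<Union>x\<in>UNIV. U x)" "\<And>x. x \<in> UNIV \<Longrightarrow> open (U x)" by blast+
  then obtain F where F: "finite F" "UNIV \<subseteq> (\<Union>x\<in>F. U x)"
    using compactE_image[OF assms, of UNIV U] by metis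
  show ?thesis
  proof
    show "finite ((\<lambda>x. (c x, cball (chart_map (c x) x) (e x))) ` F)" using F(1) by simp
    show "piece i" if "i \<in> (\<lambda>x. (c x, cball (chart_map (c x) x) (e x))) ` F" for i
      using that c e(2) unfolding piece_def by (elim imageE) (simp only: fst_conv snd_conv compact_cball simp_thms)
    fix x
    obtain y where "y \<in> F" "x \<in> U y" using F(2) by blast
    then show "\<exists>i\<in>(\<lambda>x. (c x, cball (chart_map (c x) x) (e x))) ` F. in_piece i x"
      by (auto simp: in_piece_def U_def intro!: bexI[of _ y])
  qed
qed

text \<open>On the product of the compact piece and the unit sphere the metric has a positive
  minimum and a finite maximum; homogeneity does the rest. The form "for all large C" lets finitely
  many pieces share one constant.\<close>

lemma met_bounds:
  assumes i: "piece i"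
  shows "\<forall>\<^sub>F C in at_top. \<forall>x u. in_piece i x \<longrightarrow>
    norm u \<le> C * rnorm g x (coord_vector A (fst i) x u) \<and>
    rnorm g x (coord_vector A (fst i) x u) \<le> C * norm u"
proof -
  define c Q where "c = fst i" and "Q = snd i"
  have c: "c \<in> A" "compact Q" "Q \<subseteq> chart_map c ` chart_dom c" using i by (auto simp: piece_def c_def Q_def)
  define K where "K = Q \<times> sphere (0::real^2) 1"
  define \<mu> where "\<mu> = (\<lambda>(q, u). met c q u u)"
  have K: "compact K" unfolding K_def using c(2) by (intro compact_Times) auto
  have cont: "continuous_on K \<mu>"
    unfolding continuous_on_def
  proof
    fix z assume "z \<in> K"
    then have z: "fst z \<in> chart_map c ` chart_dom c" using c(3) by (auto simp: K_def)
    have "((\<lambda>y. met c (fst y) (snd y) (snd y)) \<longlongrightarrow> met c (fst z) (snd z) (snd z)) (at z within K)"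
      by (rule met_tendsto[OF c(1) z]) (auto intro!: tendsto_intros)
    then show "(\<mu> \<longlongrightarrow> \<mu> z) (at z within K)" by (simp add: \<mu>_def case_prod_beta')
  qed
  obtain a b where ab: "a > 0" "\<And>q u. q \<in> Q \<Longrightarrow> norm u = 1 \<Longrightarrow> a \<le> met c q u u \<and> met c q u u \<le> b"
  proof (cases "K = {}")
    case True
    have "norm (axis 1 1 :: real^2) = 1" by simp
    then have "axis 1 1 \<in> sphere (0::real^2) 1" by simp
    then have "Q = {}" using True unfolding K_def by blast
    then show ?thesis using that[of 1 0] by simp
  next
    case False
    obtain z where z: "z \<in> K" "\<And>y. y \<in> K \<Longrightarrow> \<mu> z \<le> \<mu> y" using continuous_attains_inf[OF K False cont] by blast
    obtain w where w: "w \<in> K" "\<And>y. y \<in> K \<Longrightarrow> \<mu> y \<le> \<mu> w" using continuous_attains_sup[OF K False cont] by blast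
    show ?thesis
    proof
      have "fst z \<in> chart_map c ` chart_dom c" "snd z \<noteq> 0" using z(1) c(3) by (auto simp: K_def)
      then show "\<mu> z > 0" using met_pos[OF c(1)] by (simp add: \<mu>_def case_prod_beta')
      show "\<mu> z \<le> met c q u u \<and> met c q u u \<le> \<mu> w" if "q \<in> Q" "norm u = 1" for q u
        using z(2)[of "(q, u)"] w(2)[of "(q, u)"] that by (simp add: K_def \<mu>_def)
    qed
  qed
  have main: "norm u \<le> C * rnorm g x (coord_vector A c x u) \<and> rnorm g x (coord_vector A c x u) \<le> C * norm u"
    if C: "C \<ge> max (1 / sqrt a) (sqrt b)" and x: "x \<in> chart_dom c" "chart_map c x \<in> Q" for C x u
  proof (cases "u = 0")
    case True
    then show ?thesis using linear_0[OF linear_coord_vector[OF c(1) x(1)]] bilinear_lzero[OF bilinear_metric] by (simp add: rnorm_def)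
  next
    case False
    define e where "e = u /\<^sub>R norm u"
    define r where "r = rnorm g x (coord_vector A c x e)"
    have e: "norm e = 1" "u = norm u *\<^sub>R e" using False by (simp_all add: e_def)
    have r: "r = sqrt (met c (chart_map c x) e e)" by (simp add: r_def rnorm_def met_chart_map[OF c(1) x(1)])
    have eq: "rnorm g x (coord_vector A c x u) = norm u * r"
      by (subst e(2), subst linear_cmul[OF linear_coord_vector[OF c(1) x(1)]]) (simp add: rnorm_scale r_def)
    have "sqrt a \<le> r" "r \<le> sqrt b" using ab(2)[OF x(2) e(1)] by (auto simp: r)
    then have "r \<le> C" using C by simp
    have sa: "sqrt a > 0" using ab(1) by simp
    have one: "1 = (1 / sqrt a) * sqrt a" using sa by simp
    have "0 \<le> C" using C sa by (meson divide_nonneg_pos max.bounded_iff order_trans zero_le_one)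
    then have "(1 / sqrt a) * sqrt a \<le> C * r" using C \<open>sqrt a \<le> r\<close> sa by (intro mult_mono) auto
    then have "norm u * 1 \<le> norm u * (C * r)" using one by (intro mult_left_mono) auto
    moreover have "norm u * r \<le> norm u * C" using \<open>r \<le> C\<close> by (intro mult_left_mono) auto
    ultimately show ?thesis unfolding eq by (simp add: mult_ac)
  qed
  show ?thesis
    unfolding eventually_at_top_linorder in_piece_def c_def[symmetric] Q_def[symmetric]
    by (intro exI[of _ "max (1 / sqrt a) (sqrt b)"] allI impI, elim conjE) (rule main, assumption+)
qed

text \<open>The part of M described by piece j is a continuous image of a compact set, hence closed
  because M is Hausdorff. Derivatives of h between two pieces are thus studied over a compact
  set.\<close>

lemma compact_piece_preimage:
  assumes h: "continuous_on UNIV h" and i: "piece i" and j: "piece j"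
  shows "compact {p \<in> snd i. in_piece j (h (chart_inv (fst i) p))}"
proof -
  let ?c = "fst i" and ?d = "fst j"
  have i': "?c \<in> A" "compact (snd i)" "snd i \<subseteq> chart_map ?c ` chart_dom ?c"
    and j': "?d \<in> A" "compact (snd j)" "snd j \<subseteq> chart_map ?d ` chart_dom ?d"
    using i j by (auto simp: piece_def)
  have "compact (chart_inv ?d ` snd j)"
    using compact_continuous_image continuous_on_subset chart(4)[OF j'(1)] j' by blast
  then have cl: "closed (chart_inv ?d ` snd j)" by (rule compact_imp_closed)
  have "continuous_on (snd i) (h \<circ> chart_inv ?c)"
    using continuous_on_subset[OF chart(4)[OF i'(1)] i'(3)] continuous_on_subset[OF h]
    by (intro continuous_on_compose) auto
  then have "closed (snd i \<inter> (h \<circ> chart_inv ?c) -` (chart_inv ?d ` snd j))"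
    using continuous_closed_preimage cl compact_imp_closed[OF i'(2)] by blast
  from compact_Int_closed[OF i'(2) this]
  have "compact (snd i \<inter> (h \<circ> chart_inv ?c) -` (chart_inv ?d ` snd j))"
    by (simp only: inf_left_idem)
  moreover have "in_piece j y \<longleftrightarrow> y \<in> chart_inv ?d ` snd j" for y
  proof
    assume "in_piece j y"
    then show "y \<in> chart_inv ?d ` snd j"
      using inv_map[OF j'(1)] unfolding in_piece_def by (metis imageI)
  next
    assume "y \<in> chart_inv ?d ` snd j"
    then obtain q where "q \<in> snd j" "y = chart_inv ?d q" by blast
    moreover have "q \<in> chart_map ?d ` chart_dom ?d" using calculation j'(3) by blast
    ultimately show "in_piece j y" using chart(5,6)[OF j'(1)] by (simp add: in_piece_def)
  qed
  then have "{p \<in> snd i. in_piece j (h (chart_inv ?c p))} = snd i \<inter> (h \<circ> chart_inv ?c) -` (chart_inv ?d ` snd j)"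
    by auto
  ultimately show ?thesis by simp
qed

lemma piece_preimage_subset:
  assumes i: "piece i"
  shows "{p \<in> snd i. in_piece j (h (chart_inv (fst i) p))} \<subseteq> loc_dom (fst i) (fst j) h"
  using i mem_loc_dom[of "fst i" _ "fst j" h] unfolding piece_def in_piece_def by blast

lemma in_piece_preimage:
  assumes i: "piece i" "in_piece i x" and j: "in_piece j (h x)"
  shows "chart_map (fst i) x \<in> {p \<in> snd i. in_piece j (h (chart_inv (fst i) p))}"
  using assms inv_map[of "fst i" x] by (simp add: piece_def in_piece_def)

lemma continuous_on_loc_deriv:
  assumes "C1_map A h" "c \<in> A" "d \<in> A"
  shows "continuous_on (loc_dom c d h) (\<lambda>p. loc_deriv c d h p b)"
  using C1_loc_rep[OF assms] unfolding Ck_on_1_iff loc_deriv_def by blast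

lemma loc_deriv_bounded:
  assumes h: "C1_map A h" and i: "piece i" and j: "piece j"
  shows "\<forall>\<^sub>F M in at_top. \<forall>x. in_piece i x \<and> in_piece j (h x) \<longrightarrow>
    (\<forall>b\<in>Basis. norm (loc_deriv (fst i) (fst j) h (chart_map (fst i) x) b) \<le> M)"
proof -
  let ?P = "{p \<in> snd i. in_piece j (h (chart_inv (fst i) p))}"
  have c: "fst i \<in> A" "fst j \<in> A" using i j by (auto simp: piece_def)
  have hc: "continuous_on UNIV h" using h by (simp add: C1_map_def)
  have "\<forall>\<^sub>F M in at_top. \<forall>x. in_piece i x \<and> in_piece j (h x) \<longrightarrow>
    norm (loc_deriv (fst i) (fst j) h (chart_map (fst i) x) b) \<le> M" for b
  proof -
    have "continuous_on ?P (\<lambda>p. loc_deriv (fst i) (fst j) h p b)"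
      using continuous_on_subset[OF continuous_on_loc_deriv[OF h c] piece_preimage_subset[OF i]] .
    then have "bounded ((\<lambda>p. loc_deriv (fst i) (fst j) h p b) ` ?P)"
      using compact_continuous_image compact_piece_preimage[OF hc i j] compact_imp_bounded by blast
    then obtain B where B: "\<And>p. p \<in> ?P \<Longrightarrow> norm (loc_deriv (fst i) (fst j) h p b) \<le> B"
      unfolding bounded_iff by blast
    have "norm (loc_deriv (fst i) (fst j) h (chart_map (fst i) x) b) \<le> M"
      if "M \<ge> B" "in_piece i x" "in_piece j (h x)" for M x
      using order_trans[OF B[OF in_piece_preimage[where h = h, OF i that(2,3)]] that(1)] .
    then show ?thesis unfolding eventually_at_top_linorder by (intro exI[of _ B] allI impI) simp
  qed
  then have "\<forall>\<^sub>F M in at_top. \<forall>b\<in>Basis. \<forall>x. in_piece i x \<and> in_piece j (h x) \<longrightarrow>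
    norm (loc_deriv (fst i) (fst j) h (chart_map (fst i) x) b) \<le> M"
    by (simp add: eventually_ball_finite)
  then show ?thesis by (rule eventually_mono) blast
qed

text \<open>A Lebesgue number argument: the open sets on which the derivative oscillates by less
  than \<epsilon> cover the compact set of relevant coordinates, so one radius works at all of its
  points. Here "for all small r" again permits a common choice over finitely many pairs.\<close>

lemma loc_deriv_uniform:
  assumes h: "C1_map A h" and i: "piece i" and j: "piece j" and \<epsilon>: "\<epsilon> > 0"
  shows "\<forall>\<^sub>F r in at_right 0. \<forall>x. in_piece i x \<and> in_piece j (h x) \<longrightarrow>
    (\<forall>q\<in>ball (chart_map (fst i) x) r. q \<in> loc_dom (fst i) (fst j) h \<and>
      (\<forall>b\<in>Basis. dist (loc_deriv (fst i) (fst j) h q b)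
         (loc_deriv (fst i) (fst j) h (chart_map (fst i) x) b) < \<epsilon>))"
proof -
  let ?P = "{p \<in> snd i. in_piece j (h (chart_inv (fst i) p))}"
  let ?D = "loc_deriv (fst i) (fst j) h" and ?S = "loc_dom (fst i) (fst j) h"
  have c: "fst i \<in> A" "fst j \<in> A" using i j by (auto simp: piece_def)
  have hc: "continuous_on UNIV h" using h by (simp add: C1_map_def)
  note S = open_loc_dom[OF c hc]
  define \<G> where "\<G> = {G. open G \<and> G \<subseteq> ?S \<and> (\<forall>b\<in>Basis. \<forall>q\<in>G. \<forall>q'\<in>G. dist (?D q b) (?D q' b) < \<epsilon>)}"
  have cov: "?P \<subseteq> \<Union>\<G>"
  proof
    fix p assume "p \<in> ?P"
    then have p: "p \<in> ?S" using piece_preimage_subset[OF i] by blast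
    define G where "G = ?S \<inter> (\<Inter>b\<in>Basis. {q\<in>?S. ?D q b \<in> ball (?D p b) (\<epsilon> / 2)})"
    have "open {q\<in>?S. ?D q b \<in> ball (?D p b) (\<epsilon> / 2)}" for b
    proof -
      have "open ((\<lambda>q. ?D q b) -` ball (?D p b) (\<epsilon> / 2) \<inter> ?S)"
        using continuous_on_open_vimage[OF S, of "\<lambda>q. ?D q b"] continuous_on_loc_deriv[OF h c, of b] open_ball
        by blast
      moreover have "{q\<in>?S. ?D q b \<in> ball (?D p b) (\<epsilon> / 2)} = (\<lambda>q. ?D q b) -` ball (?D p b) (\<epsilon> / 2) \<inter> ?S"
        by auto
      ultimately show ?thesis by simp
    qed
    then have "open G" unfolding G_def using S by (intro open_Int open_INT) auto
    moreover have "dist (?D q b) (?D q' b) < \<epsilon>" if "b \<in> Basis" "q \<in> G" "q' \<in> G" for b q q'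
      using that dist_triangle_half_r[of "?D p b" "?D q b" \<epsilon> "?D q' b"] by (auto simp: G_def)
    moreover have "p \<in> G" using p \<epsilon> by (simp add: G_def)
    moreover have "G \<subseteq> ?S" by (simp add: G_def)
    ultimately have "G \<in> \<G>" "p \<in> G" by (simp_all add: \<G>_def)
    then show "p \<in> \<Union>\<G>" by (rule UnionI)
  qed
  have op: "\<And>G. G \<in> \<G> \<Longrightarrow> open G" by (simp add: \<G>_def)
  obtain e where e: "0 < e" "\<And>p. p \<in> ?P \<Longrightarrow> \<exists>G\<in>\<G>. ball p e \<subseteq> G"
    by (rule Heine_Borel_lemma[OF compact_piece_preimage[OF hc i j] cov], erule op) (rule that)
  have main: "q \<in> ?S \<and> (\<forall>b\<in>Basis. dist (?D q b) (?D (chart_map (fst i) x) b) < \<epsilon>)"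
    if asm: "0 < r" "r < e" "in_piece i x" "in_piece j (h x)" "q \<in> ball (chart_map (fst i) x) r" for r x q
  proof -
    obtain G where G: "G \<in> \<G>" "ball (chart_map (fst i) x) e \<subseteq> G"
      using e(2)[OF in_piece_preimage[where h = h, OF i asm(3,4)]] by blast
    have "q \<in> G" "chart_map (fst i) x \<in> G" using G(2) asm(2,5) e(1) by auto
    then show ?thesis using G(1) unfolding \<G>_def by blast
  qed
  show ?thesis
    unfolding eventually_at_right_field
    by (intro exI[of _ e] conjI[OF e(1)] allI impI ballI, elim conjE, rule main)
qed

end

section \<open>Periodic sinks\<close>

lemma continuous_on_funpow:
  fixes f :: "'a::topological_space \<Rightarrow> 'a"
  assumes "continuous_on UNIV f" shows "continuous_on UNIV (f ^^ k)"
proof (induction k)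
  case (Suc k)
  then show ?case
    using continuous_on_compose[of UNIV "f ^^ k" f] continuous_on_subset[OF assms] by simp
qed (simp add: id_def)

text \<open>Passes from the fixed point P of f^n to the full orbit under f. Everything is stated
  with open sets, so it can be fed from computations in a single chart.\<close>

lemma periodic_sink:
  fixes f :: "'a::topological_space \<Rightarrow> 'a"
  assumes f: "continuous_on UNIV f" and n: "n \<ge> 1" "(f ^^ n) P = P"
    and V0: "open V0" "P \<in> V0"
    and stable: "\<And>U. open U \<Longrightarrow> P \<in> U \<Longrightarrow> \<exists>V. open V \<and> P \<in> V \<and> (\<forall>l. (f ^^ (n * l)) ` V \<subseteq> U)"
    and conv: "\<And>y. y \<in> V0 \<Longrightarrow> (\<lambda>l. (f ^^ (n * l)) y) \<longlonglongrightarrow> P"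
    and x: "(f ^^ m) x \<in> V0"
  shows "\<exists>S. attracting_periodic_orbit f S \<and> x \<in> basin f S"
proof -
  define S where "S = {(f ^^ k) P | k. True}"
  have open_pre: "open ((f ^^ k) -` U)" if "open U" for k U
    using continuous_on_funpow[OF f, of k] that by (simp add: continuous_on_open_vimage)
  have add: "(f ^^ i) ((f ^^ j) z) = (f ^^ (i + j)) z" for i j z by (simp add: funpow_add)
  have per: "(f ^^ (n * k)) P = P" for k
    by (induction k) (simp_all add: funpow_add n(2))
  \<comment> \<open>Points whose iterates at times 0 to n - 1 lie in U. Division with remainder then
    extends control at multiples of n to all times.\<close>
  define core where "core U = (\<Inter>t\<in>{..<n}. (f ^^ t) -` U)" for U
  have core: "open (core U)" "P \<in> core U" if "open U" "S \<subseteq> U" for U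
    using that open_pre by (auto simp: core_def S_def)
  have core_orbit: "(f ^^ j) z \<in> U" if "(f ^^ (n * (j div n))) z \<in> core U" for j z U
  proof -
    have "(f ^^ (j mod n)) ((f ^^ (n * (j div n))) z) \<in> U" using that n(1) by (simp add: core_def)
    then show ?thesis unfolding add by simp
  qed
  \<comment> \<open>The waiting time that brings the k-th point of the orbit back to P; since n is
    at least 1, the subtraction does not truncate.\<close>
  define q where "q k = n * Suc k - k" for k
  have "k \<le> n * Suc k" for k
    using n(1) by (metis le_SucI mult_le_mono1 mult_1 order_trans order_refl)
  then have q: "(f ^^ q k) ((f ^^ k) P) = P" for k
    unfolding add q_def using per[of "Suc k"] by simp
  have basin_V0: "z \<in> basin f S" if zV0: "(f ^^ i) z \<in> V0" for i z
    unfolding basin_def orbit_converges_to_def mem_Collect_eq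
  proof (intro allI impI)
    fix U assume "open U \<and> S \<subseteq> U"
    then have U: "open U" "S \<subseteq> U" by blast+
    have "\<forall>\<^sub>F l in sequentially. (f ^^ (n * l)) ((f ^^ i) z) \<in> core U"
      by (rule topological_tendstoD[OF conv[OF zV0] core[OF U]])
    then have "\<exists>L. \<forall>l\<ge>L. (f ^^ (n * l)) ((f ^^ i) z) \<in> core U"
      unfolding eventually_sequentially .
    then obtain L where L: "\<forall>l\<ge>L. (f ^^ (n * l)) ((f ^^ i) z) \<in> core U" ..
    have "(f ^^ j) ((f ^^ i) z) \<in> U" if "j \<ge> n * L" for j
      by (rule core_orbit, rule L[rule_format])
        (use that n(1) in \<open>simp add: less_eq_div_iff_mult_less_eq mult.commute\<close>)
    then have "\<forall>\<^sub>F j in sequentially. (f ^^ (j + i)) z \<in> U"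
      unfolding add eventually_sequentially by (intro exI[of _ "n * L"]) simp
    then show "\<forall>\<^sub>F j in sequentially. (f ^^ j) z \<in> U"
      using eventually_sequentially_seg[of "\<lambda>j. (f ^^ j) z \<in> U" i] by simp
  qed
  have "asymptotically_stable f S"
    unfolding asymptotically_stable_def
  proof (intro conjI allI impI)
    fix U assume U: "open U \<and> S \<subseteq> U"
    then obtain V where V: "open V" "P \<in> V" "\<And>l. (f ^^ (n * l)) ` V \<subseteq> core U"
      using stable core by metis
    \<comment> \<open>Points that stay in U during some waiting time and are in V at its end; from
      then on \<open>core U\<close> takes over.\<close>
    define V' where "V' = (\<Union>k. (f ^^ q k) -` V \<inter> (\<Inter>t\<in>{..<q k}. (f ^^ t) -` U))"
    have "open V'" unfolding V'_def using open_pre V(1) U by (intro open_UN open_Int open_INT ballI) auto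
    moreover have "S \<subseteq> V'"
    proof
      fix z assume "z \<in> S"
      then obtain k where k: "z = (f ^^ k) P" by (auto simp: S_def)
      have "(f ^^ t) z \<in> U" for t
      proof -
        have "(f ^^ t) z \<in> S" unfolding k add S_def by blast
        then show ?thesis using U by blast
      qed
      then have "z \<in> (f ^^ q k) -` V \<inter> (\<Inter>t\<in>{..<q k}. (f ^^ t) -` U)"
        using q[of k] V(2) by (simp add: k)
      then show "z \<in> V'" unfolding V'_def by blast
    qed
    moreover have "(f ^^ j) z \<in> U" if zV': "z \<in> V'" for j z
    proof -
      obtain k where k: "(f ^^ q k) z \<in> V" "\<And>t. t < q k \<Longrightarrow> (f ^^ t) z \<in> U"
        using zV' unfolding V'_def by auto
      show ?thesis
      proof (cases "j < q k")
        case False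
        have "(f ^^ (j - q k)) ((f ^^ q k) z) \<in> U" using core_orbit V(3) k(1) by blast
        then show ?thesis using False by (simp add: add)
      qed (use k(2) in blast)
    qed
    ultimately show "\<exists>V. open V \<and> S \<subseteq> V \<and> (\<forall>k. (f ^^ k) ` V \<subseteq> U)"
      by (intro exI[of _ V']) blast
  next
    define W where "W = (\<Union>k. (f ^^ q k) -` V0)"
    have "open W" unfolding W_def using open_pre V0(1) by blast
    moreover have "S \<subseteq> W" using q V0(2) by (auto simp: S_def W_def)
    moreover have "W \<subseteq> basin f S" using basin_V0 by (auto simp: W_def)
    ultimately show "\<exists>W. open W \<and> S \<subseteq> W \<and> W \<subseteq> basin f S" by blast
  qed
  moreover have "periodic_orbit f S" unfolding periodic_orbit_def S_def using n by blast
  ultimately show ?thesis using basin_V0[OF x] by (auto simp: attracting_periodic_orbit_def)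
qed

text \<open>Infinitely many times share one index, and a convergent subsequence in that compact set
  is Cauchy. The common index matters because coordinates can be compared only within one
  chart.\<close>

lemma close_returns:
  fixes p :: "nat \<Rightarrow> 'a::metric_space"
  assumes I: "finite I" "\<And>j. \<iota> j \<in> I" and K: "\<And>i. i \<in> I \<Longrightarrow> compact (K i)" "\<And>j. p j \<in> K (\<iota> j)" and e: "e > 0"
  obtains a b where "a < b" "\<iota> a = \<iota> b" "dist (p a) (p b) < e"
proof -
  have "finite (range \<iota>)" using I by (meson finite_subset image_subsetI)
  then obtain i where i: "infinite {j. \<iota> j = \<iota> i}"
    using pigeonhole_infinite[of "UNIV :: nat set" \<iota>] by auto
  define s where "s = enumerate {j. \<iota> j = \<iota> i}"
  have s: "strict_mono s" "\<iota> (s j) = \<iota> i" for j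
    using strict_mono_enumerate[OF i] enumerate_in_set[OF i, of j] by (auto simp: s_def)
  have "\<forall>j. (p \<circ> s) j \<in> K (\<iota> i)" using K(2) s(2) by (metis comp_apply)
  then obtain l t where t: "strict_mono t" "((p \<circ> s) \<circ> t) \<longlonglongrightarrow> l"
    using K(1)[OF I(2)] unfolding compact_eq_seq_compact_metric seq_compact_def by meson
  then obtain M where M: "\<And>m n. m \<ge> M \<Longrightarrow> n \<ge> M \<Longrightarrow> dist (((p \<circ> s) \<circ> t) m) (((p \<circ> s) \<circ> t) n) < e"
    using LIMSEQ_imp_Cauchy[OF t(2)] e unfolding Cauchy_def by metis
  show ?thesis
  proof
    show "s (t M) < s (t (Suc M))" using s(1) t(1) by (simp add: strict_mono_def)
    show "\<iota> (s (t M)) = \<iota> (s (t (Suc M)))" using s(2) by simp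
    show "dist (p (s (t M))) (p (s (t (Suc M)))) < e" using M[of M "Suc M"] by simp
  qed
qed

text \<open>The factor 2 is the number of basis vectors.\<close>

lemma linear_norm_le_basis:
  fixes L :: "real^2 \<Rightarrow> 'b::real_normed_vector"
  assumes "linear L" "\<And>b. b \<in> Basis \<Longrightarrow> norm (L b) \<le> B"
  shows "norm (L u) \<le> 2 * B * norm u"
proof -
  have "norm (L u) \<le> (\<Sum>b\<in>Basis. norm ((u \<bullet> b) *\<^sub>R L b))"
    unfolding linear_basis_expansion[OF assms(1), of u] by (rule norm_sum)
  also have "\<dots> \<le> (\<Sum>b\<in>(Basis :: (real^2) set). norm u * B)"
    using assms(2) by (intro sum_mono) (auto intro!: mult_mono Basis_le_norm)
  finally show ?thesis by (simp add: mult_ac)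
qed

section \<open>From contraction of tangent vectors along an orbit to an attracting periodic
  orbit\<close>

context surface begin

lemma open_chart_inv_image:
  assumes "c \<in> A" "open B" "B \<subseteq> chart_map c ` chart_dom c" shows "open (chart_inv c ` B)"
proof -
  have "chart_inv c ` B = chart_map c -` B \<inter> chart_dom c"
    using assms(3) chart(5,6)[OF assms(1)] inv_map[OF assms(1)] by force
  then show ?thesis using chart(1,3)[OF assms(1)] assms(2) by (metis continuous_on_open_vimage)
qed

text \<open>Mean value inequality on the convex ball: basis vectors have images of norm at most 1/8
  + 1/8 = 1/4, and the factor 2 for the dimension gives 1/2.\<close>

lemma loc_rep_lipschitz:
  assumes h: "C1_map A h" and c: "c \<in> A" "d \<in> A"
    and small: "\<And>b. b \<in> Basis \<Longrightarrow> norm (loc_deriv c d h p b) \<le> 1 / 8"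
    and unif: "\<And>q b. q \<in> ball p r \<Longrightarrow> q \<in> loc_dom c d h"
      "\<And>q b. q \<in> ball p r \<Longrightarrow> b \<in> Basis \<Longrightarrow> dist (loc_deriv c d h q b) (loc_deriv c d h p b) < 1 / 8"
    and q: "q \<in> ball p r" "q' \<in> ball p r"
  shows "dist (loc_rep c d h q) (loc_rep c d h q') \<le> 1 / 2 * dist q q'"
proof -
  have "norm (loc_rep c d h q - loc_rep c d h q') \<le> 1 / 2 * norm (q - q')"
  proof (rule differentiable_bound[OF convex_ball _ _ q])
    fix z assume z: "z \<in> ball p r"
    note D = loc_rep_derivative[OF h c unif(1)[OF z]]
    show "(loc_rep c d h has_derivative loc_deriv c d h z) (at z within ball p r)"
      using D by (rule has_derivative_at_withinI)
    have "norm (loc_deriv c d h z b) \<le> 1 / 4" if "b \<in> Basis" for b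
      using small[OF that] unif(2)[OF z that] norm_triangle_sub[of "loc_deriv c d h z b" "loc_deriv c d h p b"]
      by (simp add: dist_norm)
    then have "norm (loc_deriv c d h z u) \<le> 2 * (1 / 4) * norm u" for u
      using linear_norm_le_basis[OF has_derivative_linear[OF D]] by blast
    then show "onorm (loc_deriv c d h z) \<le> 1 / 2" by (intro onorm_bound) auto
  qed
  then show ?thesis by (simp add: dist_norm)
qed

text \<open>
  In finitely many charts, an iterate that contracts enough along the orbit of \<open>x\<close> maps the balls of
  a fixed radius about the orbit into each other; two close returns in one chart give a fixed point.
\<close>

lemma sink_from_contraction:
  assumes M: "compact (UNIV :: 'a set)" and f: "C1_map A f"
    and contr: "\<And>\<kappa>. \<kappa> > 0 \<Longrightarrow> \<exists>k\<ge>1. \<forall>j u.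
       rnorm g ((f ^^ (k * Suc j)) x) (tangent_map A (f ^^ k) ((f ^^ (k * j)) x) u)
         \<le> \<kappa> * rnorm g ((f ^^ (k * j)) x) u"
  shows "\<exists>S. attracting_periodic_orbit f S \<and> x \<in> basin f S"
proof -
  obtain I where I: "finite I" "\<And>i. i \<in> I \<Longrightarrow> piece i" "\<And>x. \<exists>i\<in>I. in_piece i x"
    using finite_pieces[OF M] by blast
  have "\<forall>\<^sub>F C in at_top. C \<ge> 1 \<and> (\<forall>i\<in>I. \<forall>x u. in_piece i x \<longrightarrow>
    norm u \<le> C * rnorm g x (coord_vector A (fst i) x u) \<and>
    rnorm g x (coord_vector A (fst i) x u) \<le> C * norm u)"
    using met_bounds I by (intro eventually_conj eventually_ge_at_top eventually_ball_finite) auto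
  then obtain C where C: "C \<ge> 1"
    "\<And>i x u. i \<in> I \<Longrightarrow> in_piece i x \<Longrightarrow> norm u \<le> C * rnorm g x (coord_vector A (fst i) x u)"
    "\<And>i x u. i \<in> I \<Longrightarrow> in_piece i x \<Longrightarrow> rnorm g x (coord_vector A (fst i) x u) \<le> C * norm u"
    unfolding eventually_at_top_linorder by (meson order_refl)
  \<comment> \<open>Going from coordinates to the metric and back costs a factor C each time; 1 / (8
    C^2) leaves 1/8 for coordinate basis vectors.\<close>
  obtain k where k: "k \<ge> 1" and contr_k: "\<And>j u.
       rnorm g ((f ^^ (k * Suc j)) x) (tangent_map A (f ^^ k) ((f ^^ (k * j)) x) u)
         \<le> 1 / (8 * C\<^sup>2) * rnorm g ((f ^^ (k * j)) x) u"
    using contr[of "1 / (8 * C\<^sup>2)"] C(1) by auto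
  define h where "h = f ^^ k"
  have h: "C1_map A h" unfolding h_def using C1_funpow[OF f] .
  have hpow: "h ^^ l = f ^^ (k * l)" for l
    unfolding h_def by (simp add: funpow_mult mult.commute)
  define y where "y j = (h ^^ j) x" for j
  have y_Suc: "y (Suc j) = h (y j)" for j by (simp add: y_def)
  have contr_y: "rnorm g (y (Suc j)) (tangent_map A h (y j) u) \<le> 1 / (8 * C\<^sup>2) * rnorm g (y j) u" for j u
    unfolding y_def hpow using contr_k[of j u] unfolding h_def .
  have "\<forall>j. \<exists>i. i \<in> I \<and> in_piece i (y j)" using I(3) by blast
  from choice[OF this] obtain \<iota> where "\<forall>j. \<iota> j \<in> I \<and> in_piece (\<iota> j) (y j)" ..
  then have \<iota>: "\<And>j. \<iota> j \<in> I" "\<And>j. in_piece (\<iota> j) (y j)" by blast+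
  define c where "c j = fst (\<iota> j)" for j
  define p where "p j = chart_map (c j) (y j)" for j
  have c: "c j \<in> A" "y j \<in> chart_dom (c j)" "p j \<in> snd (\<iota> j)" for j
    using I(2)[OF \<iota>(1)[of j]] \<iota>(2)[of j] by (auto simp: c_def p_def piece_def in_piece_def)
  define D where "D j = loc_deriv (c j) (c (Suc j)) h" for j
  have small: "norm (D j (p j) b) \<le> 1 / 8" if b: "b \<in> Basis" for j b
  proof -
    have T: "tangent_map A h (y j) (coord_vector A (c j) (y j) b)
        = coord_vector A (c (Suc j)) (y (Suc j)) (D j (p j) b)"
      using tangent_map_coord_vector[OF h c(1) c(1) c(2), of j "Suc j" b] c(2)[of "Suc j"]
      by (simp add: y_Suc D_def p_def)
    have "norm (D j (p j) b) \<le> C * rnorm g (y (Suc j)) (coord_vector A (c (Suc j)) (y (Suc j)) (D j (p j) b))"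
      using C(2)[OF \<iota>] by (simp add: c_def)
    also have "\<dots> \<le> C * (1 / (8 * C\<^sup>2) * rnorm g (y j) (coord_vector A (c j) (y j) b))"
      unfolding T[symmetric] using contr_y C(1) by (intro mult_left_mono) auto
    also have "\<dots> \<le> C * (1 / (8 * C\<^sup>2) * (C * norm b))"
      using C(1) C(3)[OF \<iota>, of j b] by (intro mult_left_mono) (auto simp: c_def)
    also have "\<dots> = 1 / 8" using C(1) b by (simp add: power2_eq_square)
    finally show ?thesis .
  qed
  \<comment> \<open>The radius depends only on h and the finitely many pieces, so it is the same at
    all times of the orbit.\<close>
  have "\<forall>\<^sub>F r in at_right 0. 0 < r \<and> (\<forall>i\<in>I. \<forall>j\<in>I. \<forall>x. in_piece i x \<and> in_piece j (h x) \<longrightarrow>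
    (\<forall>q\<in>ball (chart_map (fst i) x) r. q \<in> loc_dom (fst i) (fst j) h \<and>
      (\<forall>b\<in>Basis. dist (loc_deriv (fst i) (fst j) h q b)
         (loc_deriv (fst i) (fst j) h (chart_map (fst i) x) b) < 1 / 8)))"
    by (intro eventually_conj eventually_at_right_less eventually_ball_finite[OF I(1)] ballI
        loc_deriv_uniform[OF h I(2) I(2)]) simp_all
  then have "\<exists>r. 0 < r \<and> (\<forall>i\<in>I. \<forall>j\<in>I. \<forall>x. in_piece i x \<and> in_piece j (h x) \<longrightarrow>
    (\<forall>q\<in>ball (chart_map (fst i) x) r. q \<in> loc_dom (fst i) (fst j) h \<and>
      (\<forall>b\<in>Basis. dist (loc_deriv (fst i) (fst j) h q b)
         (loc_deriv (fst i) (fst j) h (chart_map (fst i) x) b) < 1 / 8)))"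
    by (rule eventually_happens'[OF trivial_limit_at_right_real])
  then obtain r where r: "0 < r" and unif: "\<And>i j x q. i \<in> I \<Longrightarrow> j \<in> I \<Longrightarrow> in_piece i x \<Longrightarrow> in_piece j (h x) \<Longrightarrow>
     q \<in> ball (chart_map (fst i) x) r \<Longrightarrow> q \<in> loc_dom (fst i) (fst j) h \<and>
      (\<forall>b\<in>Basis. dist (loc_deriv (fst i) (fst j) h q b) (loc_deriv (fst i) (fst j) h (chart_map (fst i) x) b) < 1 / 8)"
    by meson
  have unif_y: "q \<in> loc_dom (c j) (c (Suc j)) h"
    "b \<in> Basis \<Longrightarrow> dist (D j q b) (D j (p j) b) < 1 / 8" if "q \<in> ball (p j) r" for j q b
    using unif[OF \<iota>(1)[of j] \<iota>(1)[of "Suc j"] \<iota>(2)[of j], of q] \<iota>(2)[of "Suc j"] that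
    by (auto simp: y_Suc c_def p_def D_def)
  define \<phi> where "\<phi> j = loc_rep (c j) (c (Suc j)) h" for j
  have lip: "dist (\<phi> j q) (\<phi> j q') \<le> 1 / 2 * dist q q'" if "q \<in> ball (p j) r" "q' \<in> ball (p j) r" for j q q'
    unfolding \<phi>_def
    by (rule loc_rep_lipschitz[OF h c(1) c(1) _ _ _ that]) (use small unif_y in \<open>auto simp: D_def\<close>)
  \<comment> \<open>h^l read from the chart used at time a in the chart used at time a + l.\<close>
  define \<Phi> where "\<Phi> a l q = chart_map (c (a + l)) ((h ^^ l) (chart_inv (c a) q))" for a l q
  have ball_img: "ball (p j) r \<subseteq> chart_map (c j) ` chart_dom (c j)" for j
    using unif_y(1) mem_loc_dom[OF c(1)] by blast
  have inv_p: "chart_inv (c j) (p j) = y j" for j using inv_map[OF c(1,2)] by (simp add: p_def)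
  have "y (a + l) = (h ^^ l) (y a)" for a l
    by (simp only: y_def add.commute[of a l] funpow_add comp_apply)
  then have \<Phi>_p: "\<Phi> a l (p a) = p (a + l)" for a l
    unfolding \<Phi>_def inv_p by (simp add: p_def)
  have \<Phi>: "(h ^^ l) (chart_inv (c a) q) \<in> chart_dom (c (a + l)) \<and> \<Phi> a l q \<in> ball (p (a + l)) r"
    "dist (\<Phi> a l q) (\<Phi> a l q') \<le> (1 / 2) ^ l * dist q q'"
    if q: "q \<in> ball (p a) r" "q' \<in> ball (p a) r" for a l q q'
  proof -
    \<comment> \<open>The three claims need one another: \<open>\<Phi>\<close> factors through
      \<open>\<phi>\<close> only while the point lies in the intermediate chart, and
      \<open>\<phi>\<close> is known to contract only on the ball.\<close>
    have "\<forall>q\<in>ball (p a) r. (h ^^ l) (chart_inv (c a) q) \<in> chart_dom (c (a + l)) \<and> \<Phi> a l q \<in> ball (p (a + l)) r \<and>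
      (\<forall>q'\<in>ball (p a) r. dist (\<Phi> a l q) (\<Phi> a l q') \<le> (1 / 2) ^ l * dist q q')"
    proof (induction l)
      case 0
      have "q \<in> chart_map (c a) ` chart_dom (c a)" if "q \<in> ball (p a) r" for q
        using ball_img that by blast
      then show ?case using chart(5,6)[OF c(1)[of a]] by (simp add: \<Phi>_def del: mem_ball)
    next
      case (Suc l)
      have step: "h ((h ^^ l) (chart_inv (c a) q)) \<in> chart_dom (c (Suc (a + l)))
          \<and> \<Phi> a (Suc l) q = \<phi> (a + l) (\<Phi> a l q)" if q: "q \<in> ball (p a) r" for q
      proof -
        have 1: "(h ^^ l) (chart_inv (c a) q) \<in> chart_dom (c (a + l))" "\<Phi> a l q \<in> ball (p (a + l)) r"
          using Suc q by blast+
        have "\<Phi> a l q \<in> loc_dom (c (a + l)) (c (Suc (a + l))) h" using unif_y(1)[OF 1(2)] .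
        moreover have "chart_inv (c (a + l)) (\<Phi> a l q) = (h ^^ l) (chart_inv (c a) q)"
          unfolding \<Phi>_def using inv_map[OF c(1) 1(1)] .
        ultimately show ?thesis
          by (simp add: mem_loc_dom[OF c(1)] \<phi>_def loc_rep_def) (simp add: \<Phi>_def)
      qed
      have pa: "p a \<in> ball (p a) r" using r by simp
      have d: "dist (\<Phi> a (Suc l) q) (\<Phi> a (Suc l) q') \<le> (1 / 2) ^ Suc l * dist q q'"
        if q: "q \<in> ball (p a) r" "q' \<in> ball (p a) r" for q q'
      proof -
        have "dist (\<Phi> a (Suc l) q) (\<Phi> a (Suc l) q') \<le> 1 / 2 * dist (\<Phi> a l q) (\<Phi> a l q')"
          using step q lip Suc by metis
        also have "\<dots> \<le> 1 / 2 * ((1 / 2) ^ l * dist q q')" using Suc q by (intro mult_left_mono) auto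
        finally show ?thesis by simp
      qed
      have "\<Phi> a (Suc l) q \<in> ball (p (a + Suc l)) r" if q: "q \<in> ball (p a) r" for q
      proof -
        have "dist (p (a + Suc l)) (\<Phi> a (Suc l) q) \<le> (1 / 2) ^ Suc l * dist (p a) q"
          using d[OF pa q] by (simp only: \<Phi>_p)
        also have "\<dots> \<le> 1 * dist (p a) q" by (intro mult_right_mono power_le_one) auto
        finally show ?thesis using q by simp
      qed
      then show ?case using step d by simp
    qed
    then show "(h ^^ l) (chart_inv (c a) q) \<in> chart_dom (c (a + l)) \<and> \<Phi> a l q \<in> ball (p (a + l)) r"
      "dist (\<Phi> a l q) (\<Phi> a l q') \<le> (1 / 2) ^ l * dist q q'" using q by blast+
  qed
  have Ks: "compact (snd i)" if "i \<in> I" for i using I(2)[OF that] by (simp add: piece_def)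
  \<comment> \<open>With r/4 + r/2 = 3r/4 < r, the return map sends the ball of radius r into the
    concentric closed ball of radius 3r/4, which is complete as the fixed point theorem
    requires.\<close>
  obtain a b where ab: "a < b" "\<iota> a = \<iota> b" "dist (p a) (p b) < r / 4"
    using close_returns[of I \<iota> snd p "r / 4", OF I(1) \<iota>(1) Ks c(3)] r by auto
  define l where "l = b - a"
  have l: "a + l = b" "l \<ge> 1" "c (a + l) = c a" using ab by (auto simp: l_def c_def)
  define \<Psi> where "\<Psi> = \<Phi> a l"
  define B where "B = ball (p a) r"
  have half: "(1 / 2) ^ l \<le> (1 / 2 :: real)" using power_decreasing[OF l(2), of "1 / 2 :: real"] by simp
  have \<Psi>_lip: "dist (\<Psi> q) (\<Psi> q') \<le> 1 / 2 * dist q q'" if "q \<in> B" "q' \<in> B" for q q'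
    using \<Phi>(2)[of q a q' l] that mult_right_mono[OF half zero_le_dist[of q q']] by (simp add: \<Psi>_def B_def)
  have pa: "p a \<in> B" using r by (simp add: B_def)
  have \<Psi>_B: "\<Psi> q \<in> cball (p a) (3 / 4 * r)" if "q \<in> B" for q
  proof -
    have "dist (p a) (\<Psi> q) \<le> dist (p a) (p b) + dist (\<Psi> (p a)) (\<Psi> q)"
      using dist_triangle[of "p a" "\<Psi> q" "p b"] by (simp add: \<Psi>_def \<Phi>_p l(1))
    also have "\<dots> \<le> r / 4 + 1 / 2 * dist (p a) q" using ab(3) \<Psi>_lip[OF pa that] by simp
    also have "\<dots> \<le> 3 / 4 * r" using that by (simp add: B_def)
    finally show ?thesis by simp
  qed
  have cB: "cball (p a) (3 / 4 * r) \<subseteq> B" using r by (auto simp: B_def)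
  have "\<exists>!q. q \<in> cball (p a) (3 / 4 * r) \<and> \<Psi> q = q"
  proof (rule Banach_fix[where c = "1 / 2"])
    show "complete (cball (p a) (3 / 4 * r))" by (simp add: complete_eq_closed)
    show "cball (p a) (3 / 4 * r) \<noteq> {}" using r by simp
    show "\<Psi> ` cball (p a) (3 / 4 * r) \<subseteq> cball (p a) (3 / 4 * r)" using \<Psi>_B cB by blast
    show "\<And>q q'. q \<in> cball (p a) (3 / 4 * r) \<Longrightarrow> q' \<in> cball (p a) (3 / 4 * r) \<Longrightarrow>
      dist (\<Psi> q) (\<Psi> q') \<le> 1 / 2 * dist q q'" using \<Psi>_lip cB by blast
  qed simp_all
  then obtain z where z: "z \<in> B" "\<Psi> z = z" using cB by blast
  note ca = c(1)[of a]
  have B_img: "B \<subseteq> chart_map (c a) ` chart_dom (c a)" using ball_img by (simp add: B_def)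
  have \<Psi>_inv: "chart_inv (c a) (\<Psi> q) = (h ^^ l) (chart_inv (c a) q)" if "q \<in> B" for q
    using \<Phi>(1)[of q a q l] that inv_map[OF ca] by (simp add: \<Psi>_def \<Phi>_def l(3) B_def)
  define n where "n = k * l"
  have n: "n \<ge> 1" using k l(2) by (simp add: n_def)
  have fn: "f ^^ n = h ^^ l" by (simp add: hpow n_def)
  define P where "P = chart_inv (c a) z"
  have iter: "(\<Psi> ^^ m) q \<in> B \<and> (f ^^ (n * m)) (chart_inv (c a) q) = chart_inv (c a) ((\<Psi> ^^ m) q)
      \<and> dist ((\<Psi> ^^ m) q) z \<le> (1 / 2) ^ m * dist q z" if "q \<in> B" for q m
  proof (induction m)
    case (Suc m)
    then have m: "(\<Psi> ^^ m) q \<in> B" "dist ((\<Psi> ^^ m) q) z \<le> (1 / 2) ^ m * dist q z"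
      "(f ^^ (n * m)) (chart_inv (c a) q) = chart_inv (c a) ((\<Psi> ^^ m) q)" by blast+
    have "(f ^^ (n * Suc m)) (chart_inv (c a) q) = (f ^^ n) ((f ^^ (n * m)) (chart_inv (c a) q))"
      by (simp add: funpow_add)
    also have "\<dots> = chart_inv (c a) (\<Psi> ((\<Psi> ^^ m) q))" unfolding m(3) fn using \<Psi>_inv[OF m(1)] by simp
    finally have "(f ^^ (n * Suc m)) (chart_inv (c a) q) = chart_inv (c a) ((\<Psi> ^^ Suc m) q)" by simp
    moreover have "dist (\<Psi> ((\<Psi> ^^ m) q)) z \<le> 1 / 2 * dist ((\<Psi> ^^ m) q) z"
      using \<Psi>_lip[OF m(1) z(1)] z(2) by simp
    then have "dist ((\<Psi> ^^ Suc m) q) z \<le> (1 / 2) ^ Suc m * dist q z" using m(2) by simp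
    moreover have "(\<Psi> ^^ Suc m) q \<in> B" using \<Psi>_B[OF m(1)] cB by auto
    ultimately show ?case by blast
  qed (use that in simp)
  show ?thesis
  \<comment> \<open>The centre of the ball represents f^(k a) x, so x reaches the attracted
    neighbourhood of P at time k a.\<close>
  proof (rule periodic_sink[where n = n and P = P and m = "k * a" and ?V0.0 = "chart_inv (c a) ` B"])
    show "continuous_on UNIV f" using f by (simp add: C1_map_def)
    show "1 \<le> n" by (rule n)
    show "(f ^^ n) P = P" using \<Psi>_inv[OF z(1)] z(2) by (simp add: fn P_def)
    show "open (chart_inv (c a) ` B)"
      using open_chart_inv_image[OF ca _ B_img] by (simp add: B_def)
    show "P \<in> chart_inv (c a) ` B" using z(1) by (simp add: P_def)
    show "(f ^^ (k * a)) x \<in> chart_inv (c a) ` B"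
      using pa inv_p[of a] by (metis hpow image_eqI y_def)
  next
    fix U assume U: "open U" "P \<in> U"
    have "open (chart_map (c a) ` chart_dom (c a) \<inter> chart_inv (c a) -` U \<inter> B)"
      using open_chart_image[OF ca U(1)] unfolding chart_image_eq[OF ca] B_def by (rule open_Int) (rule open_ball)
    moreover have "z \<in> chart_map (c a) ` chart_dom (c a) \<inter> chart_inv (c a) -` U \<inter> B"
      using z(1) B_img U(2) by (auto simp: P_def)
    ultimately obtain e where e: "e > 0" "ball z e \<subseteq> chart_map (c a) ` chart_dom (c a) \<inter> chart_inv (c a) -` U \<inter> B"
      by (meson open_contains_ball)
    have "(f ^^ (n * m)) (chart_inv (c a) q) \<in> U" if q: "q \<in> ball z e" for m q
    proof -
      have qB: "q \<in> B" using q e(2) by blast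
      have "dist ((\<Psi> ^^ m) q) z \<le> (1 / 2) ^ m * dist q z" using iter[OF qB] by blast
      also have "\<dots> \<le> 1 * dist q z" by (intro mult_right_mono power_le_one) auto
      finally have "(\<Psi> ^^ m) q \<in> ball z e" using q by (simp add: dist_commute)
      then show ?thesis using iter[OF qB] e(2) by auto
    qed
    moreover have "open (chart_inv (c a) ` ball z e)"
      using open_chart_inv_image[OF ca open_ball] e(2) by blast
    moreover have "P \<in> chart_inv (c a) ` ball z e" using e(1) by (simp add: P_def)
    ultimately show "\<exists>V. open V \<and> P \<in> V \<and> (\<forall>l. (f ^^ (n * l)) ` V \<subseteq> U)"
      by (intro exI[of _ "chart_inv (c a) ` ball z e"]) auto
  next
    fix w assume "w \<in> chart_inv (c a) ` B"
    then obtain q where q: "q \<in> B" "w = chart_inv (c a) q" by blast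
    have "(\<lambda>m. (1 / 2) ^ m * dist q z) \<longlonglongrightarrow> 0 * dist q z"
      by (intro tendsto_intros LIMSEQ_power_zero) auto
    then have lim0: "(\<lambda>m. (1 / 2) ^ m * dist q z) \<longlonglongrightarrow> 0" by simp
    have "(\<lambda>m. dist ((\<Psi> ^^ m) q) z) \<longlonglongrightarrow> 0"
      by (rule tendsto_sandwich[OF _ _ tendsto_const lim0]) (use iter[OF q(1)] in \<open>auto intro!: always_eventually\<close>)
    then have "(\<lambda>m. (\<Psi> ^^ m) q) \<longlonglongrightarrow> z" by (rule tendsto_dist_iff[THEN iffD2])
    moreover have "isCont (chart_inv (c a)) z"
      using chart(2,4)[OF ca] z(1) B_img by (metis continuous_on_eq_continuous_at subsetD)
    ultimately have "(\<lambda>m. chart_inv (c a) ((\<Psi> ^^ m) q)) \<longlonglongrightarrow> P"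
      unfolding P_def using isCont_tendsto_compose by blast
    then show "(\<lambda>m. (f ^^ (n * m)) w) \<longlonglongrightarrow> P" using iter[OF q(1)] by (simp add: q(2))
  qed
qed

section \<open>Contraction along an orbit without projective distortion\<close>

text \<open>In coordinates the derivative is bounded over each pair of compact pieces; comparing
  norms at source and target adds two factors C.\<close>

lemma tangent_map_bounded:
  assumes M: "compact (UNIV :: 'a set)" and h: "C1_map A h"
  obtains B where "B \<ge> 0" "\<And>x u. rnorm g (h x) (tangent_map A h x u) \<le> B * rnorm g x u"
proof -
  obtain I where I: "finite I" "\<And>i. i \<in> I \<Longrightarrow> piece i" "\<And>x. \<exists>i\<in>I. in_piece i x"
    using finite_pieces[OF M] by blast
  have "\<forall>\<^sub>F C in at_top. C \<ge> 0 \<and> (\<forall>i\<in>I. \<forall>x u. in_piece i x \<longrightarrow>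
    norm u \<le> C * rnorm g x (coord_vector A (fst i) x u) \<and>
    rnorm g x (coord_vector A (fst i) x u) \<le> C * norm u)"
    using met_bounds I by (intro eventually_conj eventually_ge_at_top eventually_ball_finite) auto
  then obtain C where C: "C \<ge> 0"
    "\<And>i x u. i \<in> I \<Longrightarrow> in_piece i x \<Longrightarrow> norm u \<le> C * rnorm g x (coord_vector A (fst i) x u)"
    "\<And>i x u. i \<in> I \<Longrightarrow> in_piece i x \<Longrightarrow> rnorm g x (coord_vector A (fst i) x u) \<le> C * norm u"
    unfolding eventually_at_top_linorder by (meson order_refl)
  have "\<forall>\<^sub>F B in at_top. B \<ge> 0 \<and> (\<forall>i\<in>I. \<forall>j\<in>I. \<forall>x. in_piece i x \<and> in_piece j (h x) \<longrightarrow>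
    (\<forall>b\<in>Basis. norm (loc_deriv (fst i) (fst j) h (chart_map (fst i) x) b) \<le> B))"
    using loc_deriv_bounded[OF h I(2) I(2)] I(1)
    by (intro eventually_conj eventually_ge_at_top eventually_ball_finite ballI) auto
  then obtain B where B: "B \<ge> 0" "\<And>i j x b. i \<in> I \<Longrightarrow> j \<in> I \<Longrightarrow> in_piece i x \<Longrightarrow> in_piece j (h x) \<Longrightarrow>
      b \<in> Basis \<Longrightarrow> norm (loc_deriv (fst i) (fst j) h (chart_map (fst i) x) b) \<le> B"
    unfolding eventually_at_top_linorder by (meson order_refl)
  show ?thesis
  proof
    show "0 \<le> C * (2 * B * C)" using B(1) C(1) by simp
    fix x u
    obtain i j where ij: "i \<in> I" "in_piece i x" "j \<in> I" "in_piece j (h x)" using I(3) by meson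
    have ci: "fst i \<in> A" "x \<in> chart_dom (fst i)" and cj: "fst j \<in> A" "h x \<in> chart_dom (fst j)"
      using I(2)[OF ij(1)] I(2)[OF ij(3)] ij(2,4) by (auto simp: piece_def in_piece_def)
    obtain w where w: "u = coord_vector A (fst i) x w"
      using coord_vector_bij[OF ci] by (metis bij_pointE)
    let ?D = "loc_deriv (fst i) (fst j) h (chart_map (fst i) x)"
    have "chart_map (fst i) x \<in> loc_dom (fst i) (fst j) h"
      using ci cj(2) inv_map[OF ci] by (simp add: mem_loc_dom[OF ci(1)])
    then have "linear ?D" using linear_loc_deriv[OF h ci(1) cj(1)] by blast
    then have D: "norm (?D w) \<le> 2 * B * norm w"
      using linear_norm_le_basis B(2)[OF ij(1,3,2,4)] by blast
    have "rnorm g (h x) (tangent_map A h x u) \<le> C * norm (?D w)"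
      unfolding w tangent_map_coord_vector[OF h ci(1) cj(1) ci(2) cj(2)] using C(3)[OF ij(3,4)] .
    also have "\<dots> \<le> C * (2 * B * norm w)" using D C(1) by (intro mult_left_mono)
    also have "\<dots> \<le> C * (2 * B * (C * rnorm g x u))"
      unfolding w using C(1) B(1) C(2)[OF ij(1,2), of w] by (intro mult_left_mono) auto
    finally show "rnorm g (h x) (tangent_map A h x u) \<le> C * (2 * B * C) * rnorm g x u" by (simp add: mult_ac)
  qed
qed

text \<open>
  In orthonormal frames whose first vectors follow the direction of \<open>v\<close>, the tangent map is upper
  triangular with both diagonal entries of modulus \<open>sqrt |det|\<close>. The norms \<open>|\<alpha>| + L |\<beta>|\<close> in the
  coordinates of these frames are contracted once \<open>L\<close> outweighs the off-diagonal entries.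
\<close>

lemma tangent_map_contraction:
  assumes M: "compact (UNIV :: 'a set)" and F: "C1_diffeo A F" and v: "v \<noteq> 0"
    and expan: "\<And>n. n \<ge> 1 \<Longrightarrow> expan (F ^^ n) x v = 1"
    and s: "0 \<le> s" "s < 1" and det: "\<And>j. abs_det A g F ((F ^^ j) x) \<le> s\<^sup>2"
  obtains C \<rho> where "C > 0" "0 \<le> \<rho>" "\<rho> < 1" "\<And>j n u. rnorm g ((F ^^ (n + j)) x) (tangent_map A (F ^^ n) ((F ^^ j) x) u)
    \<le> C * \<rho> ^ n * rnorm g ((F ^^ j) x) u"
proof -
  have C1: "C1_map A F" using F by (simp add: C1_diffeo_def)
  obtain B where B: "B \<ge> 0" "\<And>x u. rnorm g (F x) (tangent_map A F x u) \<le> B * rnorm g x u"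
    using tangent_map_bounded[OF M C1] by blast
  define y where "y j = (F ^^ j) x" for j
  define T where "T j = tangent_map A F (y j)" for j
  define V where "V j = tangent_map A (F ^^ j) x v" for j
  have y_Suc: "y (Suc j) = F (y j)" for j by (simp add: y_def)
  have V_Suc: "V (Suc j) = T j (V j)" for j
    unfolding V_def T_def y_def by (rule tangent_map_Suc[OF atlas C1])
  have V: "V j \<noteq> 0" for j
    unfolding V_def using tangent_map_nonzero[OF atlas C1_diffeo_funpow[OF F] v] .
  have V0: "V 0 = v" using tangent_map_id[OF atlas, of x] by (simp add: V_def id_def)
  \<comment> \<open>By the cocycle rule this is the quotient of the values for j + 1 and j, both
    equal to 1. Time 0 is separate because the hypothesis starts at n = 1.\<close>
  have e1: "expan F (y j) (V j) = 1" for j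
  proof (cases "j = 0")
    case True
    then show ?thesis using expan[of 1] by (simp add: V0 y_def)
  next
    case False
    have "expan (F ^^ Suc j) x v = expan F (y j) (V j) * expan (F ^^ j) x v"
      using expan_comp[OF C1_diffeo_funpow[OF F, of j] F v, of x] by (simp add: y_def V_def)
    then show ?thesis using expan[of "Suc j"] expan[of j] False by simp
  qed
  have lin: "linear (T j)" for j unfolding T_def by (rule linear_tangent_map[OF C1])
  define D where "D j = abs_det A g F (y j)" for j
  define a where "a j = rnorm g (y j) (V j)" for j
  have a: "a j > 0" for j unfolding a_def using rnorm_pos[OF V] .
  have a_sq: "g (y j) (V j) (V j) = (a j)\<^sup>2" for j by (simp add: a_def rnorm_sq)
  have Da: "(a (Suc j))\<^sup>2 = D j * (a j)\<^sup>2" for j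
    using e1[of j] a[of j] a[of "Suc j"]
    by (simp add: expan_def D_def T_def[symmetric] y_Suc[symmetric] V_Suc[symmetric] a_sq field_simps)
  have D: "0 < D j" "D j \<le> s\<^sup>2" for j
    using Da[of j] a[of j] a[of "Suc j"] det[of j] abs_det_nonneg[of F "y j"]
    by (auto simp: D_def y_def order_less_le)
  define d where "d j = sqrt (D j)" for j
  have d: "0 < d j" "d j \<le> s" "(d j)\<^sup>2 = D j" for j
    using D[of j] s(1) by (auto simp: d_def real_le_lsqrt)
  have a_Suc: "a (Suc j) = d j * a j" for j
  proof (rule power2_eq_imp_eq)
    show "(a (Suc j))\<^sup>2 = (d j * a j)\<^sup>2" unfolding Da power_mult_distrib d(3) ..
  qed (use a[of j] a[of "Suc j"] d(1)[of j] in \<open>simp_all add: less_imp_le\<close>)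
  \<comment> \<open>\<open>\<alpha>\<close> and \<open>\<beta>\<close> are the moduli of the
    components of u along \<open>V j\<close> and orthogonal to it; \<open>\<beta>\<close> is a
    height, that is, area divided by base.\<close>
  define \<alpha> where "\<alpha> j u = \<bar>g (y j) u (V j)\<bar> / a j" for j u
  define \<beta> where "\<beta> j u = sqrt (area_sq (y j) (V j) u) / a j" for j u
  have \<alpha>0: "0 \<le> \<alpha> j u" and \<beta>0: "0 \<le> \<beta> j u" for j u
    using a[of j] area_sq_nonneg by (auto simp: \<alpha>_def \<beta>_def)
  have cs: "\<bar>g z u w\<bar> \<le> rnorm g z u * rnorm g z w" for z u w
  proof -
    have "(g z u w)\<^sup>2 \<le> (rnorm g z u * rnorm g z w)\<^sup>2"
      using area_sq_nonneg[of z u w] by (simp add: area_sq_def power_mult_distrib rnorm_sq)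
    then show ?thesis using rnorm_nonneg by (metis abs_le_square_iff abs_of_nonneg mult_nonneg_nonneg)
  qed
  have pyth: "(rnorm g (y j) u)\<^sup>2 = (\<alpha> j u)\<^sup>2 + (\<beta> j u)\<^sup>2" for j u
    using a[of j] area_sq_nonneg[of "y j" "V j" u]
    by (simp add: \<alpha>_def \<beta>_def power_divide area_sq_def rnorm_sq a_sq metric_sym[of "y j" u "V j"] field_simps)

  have norm_le: "rnorm g (y j) u \<le> \<alpha> j u + \<beta> j u" for j u
  proof (rule power2_le_imp_le)
    show "(rnorm g (y j) u)\<^sup>2 \<le> (\<alpha> j u + \<beta> j u)\<^sup>2"
      unfolding pyth using \<alpha>0[of j u] \<beta>0[of j u] by (simp add: power2_sum)
  qed (use \<alpha>0 \<beta>0 in simp)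
  have \<alpha>_le: "\<alpha> j u \<le> rnorm g (y j) u" and \<beta>_le: "\<beta> j u \<le> rnorm g (y j) u" for j u
    by (rule power2_le_imp_le; use pyth[of j u] rnorm_nonneg in simp)+
  \<comment> \<open>The area is multiplied by D = d^2 and the base by d, so the height is multiplied
    by d.\<close>
  have \<beta>_step: "\<beta> (Suc j) (T j u) \<le> s * \<beta> j u" for j u
  proof -
    have "area_sq (y (Suc j)) (V (Suc j)) (T j u) = (D j)\<^sup>2 * area_sq (y j) (V j) u"
      unfolding V_Suc T_def y_Suc D_def by (rule area_sq_tangent_map[OF C1])
    then have "\<beta> (Suc j) (T j u) = D j * sqrt (area_sq (y j) (V j) u) / (d j * a j)"
      using D(1)[of j] by (simp add: \<beta>_def a_Suc real_sqrt_mult)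
    also have "\<dots> = d j * \<beta> j u"
      using d(1)[of j] a[of j] by (simp add: \<beta>_def d(3)[symmetric] power2_eq_square)
    also have "\<dots> \<le> s * \<beta> j u" using d(2) \<beta>0 by (intro mult_right_mono)
    finally show ?thesis .
  qed
  have \<alpha>_step: "\<alpha> (Suc j) (T j u) \<le> s * \<alpha> j u + B * \<beta> j u" for j u
  proof -
    \<comment> \<open>Orthogonal splitting of u along \<open>V j\<close>: the remainder w has norm
      \<open>\<beta> j u\<close>, and the bound B on the tangent map controls what it contributes
      off the diagonal.\<close>
    define t where "t = g (y j) u (V j) / (a j)\<^sup>2"
    define w where "w = u - t *\<^sub>R V j"
    have u: "u = t *\<^sub>R V j + w" by (simp add: w_def)
    have wV: "g (y j) w (V j) = 0"
      using a[of j] by (simp add: w_def bilinear_lsub[OF bilinear_metric] bilinear_lmul[OF bilinear_metric] a_sq t_def)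
    have area_w: "area_sq (y j) (V j) w = area_sq (y j) (V j) u"
      by (simp add: area_sq_eq w_def) (simp add: algebra_simps)
    have "(rnorm g (y j) w)\<^sup>2 = (\<beta> j u)\<^sup>2"
      unfolding pyth by (simp add: \<alpha>_def \<beta>_def wV area_w)
    then have w: "rnorm g (y j) w = \<beta> j u" using rnorm_nonneg \<beta>0 by (simp add: power2_eq_iff_nonneg)
    have Tu: "T j u = t *\<^sub>R V (Suc j) + T j w"
      by (subst u) (simp add: linear_add[OF lin] linear_cmul[OF lin] V_Suc)
    have "\<bar>g (y (Suc j)) (T j u) (V (Suc j))\<bar> \<le> \<bar>t\<bar> * (a (Suc j))\<^sup>2 + \<bar>g (y (Suc j)) (T j w) (V (Suc j))\<bar>"
      unfolding Tu bilinear_ladd[OF bilinear_metric] bilinear_lmul[OF bilinear_metric] a_sq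
      using abs_triangle_ineq[of "t * (a (Suc j))\<^sup>2"] by (simp add: abs_mult)
    also have "\<dots> \<le> \<bar>t\<bar> * (a (Suc j))\<^sup>2 + (B * \<beta> j u) * a (Suc j)"
    proof -
      have "\<bar>g (y (Suc j)) (T j w) (V (Suc j))\<bar> \<le> rnorm g (y (Suc j)) (T j w) * a (Suc j)"
        unfolding a_def by (rule cs)
      also have "\<dots> \<le> (B * \<beta> j u) * a (Suc j)"
        using B(2)[of "y j" w] a[of "Suc j"] by (intro mult_right_mono) (auto simp: T_def y_Suc w)
      finally show ?thesis by simp
    qed
    finally have "\<alpha> (Suc j) (T j u) \<le> \<bar>t\<bar> * a (Suc j) + B * \<beta> j u"
      using a[of "Suc j"] by (simp add: \<alpha>_def divide_simps power2_eq_square algebra_simps)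
    also have "\<bar>t\<bar> * a (Suc j) = d j * \<alpha> j u"
      using a[of j] by (simp add: t_def \<alpha>_def a_Suc power2_eq_square)
    also have "\<dots> \<le> s * \<alpha> j u" using d(2) \<alpha>0 by (intro mult_right_mono)
    finally show ?thesis by simp
  qed
  \<comment> \<open>The rate is the midpoint of s and 1. The weight must satisfy B + L s <= \<rho>
    L, that is, L (1 - s) >= 2 B; the added 1 gives L >= 1, so that \<open>Nm\<close> dominates the
    norm.\<close>
  define \<rho> where "\<rho> = (1 + s) / 2"
  define L where "L = 2 * B / (1 - s) + 1"
  have L: "1 \<le> L" using B(1) s by (simp add: L_def)
  have \<rho>: "0 \<le> \<rho>" "\<rho> < 1" "s \<le> \<rho>" using s by (auto simp: \<rho>_def)
  have "L * (1 - s) = 2 * B + (1 - s)" using s(2) by (simp add: L_def field_simps)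
  then have BL: "B + L * s \<le> \<rho> * L" using s(2) by (simp add: \<rho>_def algebra_simps)
  define Nm where "Nm j u = \<alpha> j u + L * \<beta> j u" for j u
  have Nm_step: "Nm (Suc j) (T j u) \<le> \<rho> * Nm j u" for j u
  proof -
    have "Nm (Suc j) (T j u) \<le> (s * \<alpha> j u + B * \<beta> j u) + L * (s * \<beta> j u)"
      unfolding Nm_def using \<alpha>_step \<beta>_step L by (intro add_mono mult_left_mono) auto
    also have "\<dots> = s * \<alpha> j u + (B + L * s) * \<beta> j u" by (simp add: algebra_simps)
    also have "\<dots> \<le> \<rho> * \<alpha> j u + (\<rho> * L) * \<beta> j u"
      using \<rho>(3) BL \<alpha>0 \<beta>0 by (intro add_mono mult_right_mono) auto
    finally show ?thesis by (simp add: Nm_def algebra_simps)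
  qed
  have Tn: "Nm (n + j) (tangent_map A (F ^^ n) (y j) u) \<le> \<rho> ^ n * Nm j u" for n j u
  proof (induction n)
    case 0
    then show ?case using tangent_map_id[OF atlas, of "y j"] by (simp add: id_def)
  next
    case (Suc n)
    have "tangent_map A (F ^^ Suc n) (y j) u = T (n + j) (tangent_map A (F ^^ n) (y j) u)"
      unfolding tangent_map_Suc[OF atlas C1] by (simp add: T_def y_def funpow_add)
    then have "Nm (Suc n + j) (tangent_map A (F ^^ Suc n) (y j) u) \<le> \<rho> * Nm (n + j) (tangent_map A (F ^^ n) (y j) u)"
      using Nm_step by simp
    also have "\<dots> \<le> \<rho> * (\<rho> ^ n * Nm j u)" using Suc \<rho>(1) by (intro mult_left_mono)
    finally show ?case by (simp only: power_Suc mult.assoc)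
  qed
  have *: "rnorm g (y (n + j)) (tangent_map A (F ^^ n) (y j) u) \<le> (1 + L) * \<rho> ^ n * rnorm g (y j) u" for n j u
  proof -
    have "rnorm g (y (n + j)) z \<le> Nm (n + j) z" for z
      using norm_le[of "n + j" z] mult_right_mono[OF L \<beta>0[of "n + j" z]] by (simp add: Nm_def)
    then have "rnorm g (y (n + j)) (tangent_map A (F ^^ n) (y j) u) \<le> \<rho> ^ n * Nm j u"
      using Tn order_trans by blast
    also have "\<dots> \<le> \<rho> ^ n * ((1 + L) * rnorm g (y j) u)"
    proof (rule mult_left_mono)
      have "Nm j u \<le> rnorm g (y j) u + L * rnorm g (y j) u"
        unfolding Nm_def using \<alpha>_le \<beta>_le L by (intro add_mono mult_left_mono) auto
      then show "Nm j u \<le> (1 + L) * rnorm g (y j) u" by (simp add: algebra_simps)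
    qed (use \<rho>(1) in simp)
    finally show ?thesis by (simp add: mult_ac)
  qed
  show ?thesis
    by (rule that[of "1 + L" \<rho>]) (use L \<rho> *[unfolded y_def] in auto)
qed

section \<open>Limits of almost homothetic directions\<close>

text \<open>A subsequence of base points and directions is chosen once, independently of n. For each
  fixed n, continuity of \<open>expan\<close> and the two bounds tending to 1 then squeeze the value
  at the limit.\<close>

lemma homothetic_limit:
  assumes M: "compact (UNIV :: 'a set)" and F: "C1_diffeo A F" and K: "closed K"
    and almost: "\<And>\<delta>. 0 < \<delta> \<Longrightarrow> \<delta> < 1 \<Longrightarrow> \<exists>x\<in>K. \<exists>v\<in>unit_tangent g x. \<forall>n\<ge>1.
      (1 - \<delta>) ^ n < expan (F ^^ n) x v \<and> expan (F ^^ n) x v < (1 + \<delta>) ^ n"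
  shows "\<exists>x\<in>K. \<exists>v. v \<noteq> 0 \<and> (\<forall>n\<ge>1. expan (F ^^ n) x v = 1)"
proof -
  obtain I where I: "finite I" "\<And>i. i \<in> I \<Longrightarrow> piece i" "\<And>x. \<exists>i\<in>I. in_piece i x"
    using finite_pieces[OF M] by blast
  define \<delta> :: "nat \<Rightarrow> real" where "\<delta> k = 1 / (real k + 2)" for k
  have \<delta>: "0 < \<delta> k" "\<delta> k < 1" for k by (auto simp: \<delta>_def)
  have \<delta>0: "\<delta> \<longlonglongrightarrow> 0"
    unfolding \<delta>_def using LIMSEQ_ignore_initial_segment[OF lim_1_over_n[where 'a = real], of 2] by (simp add: add.commute)
  have "\<forall>k. \<exists>x v. x \<in> K \<and> v \<in> unit_tangent g x \<and> (\<forall>n\<ge>1.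
      (1 - \<delta> k) ^ n < expan (F ^^ n) x v \<and> expan (F ^^ n) x v < (1 + \<delta> k) ^ n)"
    using almost[OF \<delta>] by blast
  then obtain X V where XV: "\<And>k. X k \<in> K" "\<And>k. V k \<in> unit_tangent g (X k)"
    "\<And>k n. n \<ge> 1 \<Longrightarrow> (1 - \<delta> k) ^ n < expan (F ^^ n) (X k) (V k) \<and> expan (F ^^ n) (X k) (V k) < (1 + \<delta> k) ^ n"
    by metis
  have "\<forall>k. \<exists>i. i \<in> I \<and> in_piece i (X k)" using I(3) by blast
  from choice[OF this] obtain \<iota> where "\<forall>k. \<iota> k \<in> I \<and> in_piece (\<iota> k) (X k)" ..
  then have \<iota>: "\<And>k. \<iota> k \<in> I" "\<And>k. in_piece (\<iota> k) (X k)" by blast+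
  have "finite (range \<iota>)" using I(1) \<iota>(1) by (meson finite_subset image_subsetI)
  then obtain k0 where k0: "infinite {k. \<iota> k = \<iota> k0}"
    using pigeonhole_infinite[of "UNIV :: nat set" \<iota>] by auto
  define s where "s = enumerate {k. \<iota> k = \<iota> k0}"
  have s: "strict_mono s" "\<iota> (s k) = \<iota> k0" for k
    using strict_mono_enumerate[OF k0] enumerate_in_set[OF k0, of k] by (auto simp: s_def)
  define c Q where "c = fst (\<iota> k0)" and "Q = snd (\<iota> k0)"
  have c: "c \<in> A" "compact Q" "Q \<subseteq> chart_map c ` chart_dom c"
    using I(2)[OF \<iota>(1)] by (auto simp: c_def Q_def piece_def)
  have Xc: "X (s k) \<in> chart_dom c" "chart_map c (X (s k)) \<in> Q" for k
    using \<iota>(2)[of "s k"] s(2)[of k] by (auto simp: c_def Q_def in_piece_def)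
  have "\<exists>w. coord_vector A c (X (s k)) w = V (s k) \<and> w \<noteq> 0" for k
  proof -
    obtain w where w: "coord_vector A c (X (s k)) w = V (s k)"
      using coord_vector_bij[OF c(1) Xc(1)] by (metis bij_pointE)
    have "V (s k) \<noteq> 0" using XV(2)[of "s k"] bilinear_lzero[OF bilinear_metric] by (auto simp: unit_tangent_def rnorm_def)
    then show ?thesis using w linear_0[OF linear_coord_vector[OF c(1) Xc(1)]] by metis
  qed
  then obtain w where w: "\<And>k. coord_vector A c (X (s k)) (w k) = V (s k)" "\<And>k. w k \<noteq> 0" by metis
  define p where "p k = chart_map c (X (s k))" for k
  \<comment> \<open>Directions are normalised in the Euclidean norm of the chart, whose unit sphere
    is compact and does not move with the base point; \<open>expan\<close> ignores the
    rescaling.\<close>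
  define u where "u k = w k /\<^sub>R norm (w k)" for k
  have "compact (Q \<times> sphere (0::real^2) 1)" using c(2) by (intro compact_Times) auto
  moreover have "\<forall>k. (p k, u k) \<in> Q \<times> sphere 0 1" using Xc(2) w(2) by (simp add: p_def u_def)
  ultimately obtain l t where t: "l \<in> Q \<times> sphere (0::real^2) 1" "strict_mono t" "((\<lambda>k. (p k, u k)) \<circ> t) \<longlonglongrightarrow> l"
    unfolding compact_eq_seq_compact_metric seq_compact_def by meson
  define p0 u0 where "p0 = fst l" and "u0 = snd l"
  have p: "(\<lambda>k. p (t k)) \<longlonglongrightarrow> p0" and u: "(\<lambda>k. u (t k)) \<longlonglongrightarrow> u0"
    using tendsto_fst[OF t(3)] tendsto_snd[OF t(3)] by (auto simp: p0_def u0_def o_def)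
  have p0: "p0 \<in> chart_map c ` chart_dom c" and u0: "u0 \<noteq> 0"
    using t(1) c(3) by (auto simp: p0_def u0_def)
  define x where "x = chart_inv c p0"
  have inv_p: "chart_inv c (p k) = X (s k)" for k using inv_map[OF c(1) Xc(1)] by (simp add: p_def)
  have "isCont (chart_inv c) p0" using chart(2,4)[OF c(1)] p0 by (metis continuous_on_eq_continuous_at)
  then have "(\<lambda>k. chart_inv c (p (t k))) \<longlonglongrightarrow> x" unfolding x_def using isCont_tendsto_compose p by blast
  then have "(\<lambda>k. X (s (t k))) \<longlonglongrightarrow> x" by (simp add: inv_p)
  then have xK: "x \<in> K" by (rule Lim_in_closed_set[OF K _ sequentially_bot, rotated]) (simp add: XV(1))
  have st: "strict_mono (\<lambda>k. s (t k))" using s(1) t(2) by (simp add: strict_mono_def)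
  have \<delta>st: "(\<lambda>k. \<delta> (s (t k))) \<longlonglongrightarrow> 0" using LIMSEQ_subseq_LIMSEQ[OF \<delta>0 st] by (simp add: o_def)
  have "expan (F ^^ n) x (coord_vector A c x u0) = 1" if n: "n \<ge> 1" for n
  proof -
    have Fn: "C1_map A (F ^^ n)" using C1_diffeo_funpow[OF F] by (simp add: C1_diffeo_def)
    have "(\<lambda>k. expan (F ^^ n) (chart_inv c (p (t k))) (coord_vector A c (chart_inv c (p (t k))) (u (t k))))
      \<longlonglongrightarrow> expan (F ^^ n) x (coord_vector A c x u0)"
      unfolding x_def by (rule expan_tendsto[OF C1_diffeo_funpow[OF F] c(1) p0 p u u0])
    moreover have "expan (F ^^ n) (chart_inv c (p k)) (coord_vector A c (chart_inv c (p k)) (u k))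
        = expan (F ^^ n) (X (s k)) (V (s k))" for k
      unfolding inv_p u_def linear_cmul[OF linear_coord_vector[OF c(1) Xc(1)]] w(1)
      using expan_scale[OF Fn] w(2) by simp
    ultimately have 1: "(\<lambda>k. expan (F ^^ n) (X (s (t k))) (V (s (t k)))) \<longlonglongrightarrow> expan (F ^^ n) x (coord_vector A c x u0)"
      by simp
    have "(\<lambda>k. (1 - \<delta> (s (t k))) ^ n) \<longlonglongrightarrow> (1 - 0) ^ n" "(\<lambda>k. (1 + \<delta> (s (t k))) ^ n) \<longlonglongrightarrow> (1 + 0) ^ n"
      by (intro tendsto_intros \<delta>st)+
    then have 2: "(\<lambda>k. (1 - \<delta> (s (t k))) ^ n) \<longlonglongrightarrow> 1" "(\<lambda>k. (1 + \<delta> (s (t k))) ^ n) \<longlonglongrightarrow> 1" by simp_all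
    have "(\<lambda>k. expan (F ^^ n) (X (s (t k))) (V (s (t k)))) \<longlonglongrightarrow> 1"
      by (rule tendsto_sandwich[OF _ _ 2]) (use XV(3)[OF n] in \<open>auto intro!: always_eventually less_imp_le\<close>)
    then show ?thesis using LIMSEQ_unique 1 by blast
  qed
  moreover have "coord_vector A c x u0 \<noteq> 0"
    using met_pos[OF c(1) p0 u0] bilinear_lzero[OF bilinear_metric] by (auto simp: met_def x_def)
  ultimately show ?thesis using xK by blast
qed

section \<open>Dissipation as a determinant bound, and the conclusion\<close>

lemma abs_det_le:
  assumes h: "C1_map A h" and B: "\<And>x u. rnorm g (h x) (tangent_map A h x u) \<le> B * rnorm g x u"
  shows "abs_det A g h x \<le> B\<^sup>2"
proof (rule power2_le_imp_le)
  obtain v where v: "v \<in> unit_tangent g x" using unit_tangent_exists by blast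
  define w where "w = unit_normal g x v"
  have w: "w \<in> unit_tangent g x" "g x v w = 0" using unit_normal_exists[OF metric v] by (auto simp: w_def)
  have le: "g (h x) (tangent_map A h x u) (tangent_map A h x u) \<le> B\<^sup>2" if "u \<in> unit_tangent g x" for u
  proof -
    have "(rnorm g (h x) (tangent_map A h x u))\<^sup>2 \<le> B\<^sup>2"
      using B[of x u] that rnorm_nonneg by (intro power_mono) (auto simp: unit_tangent_def)
    then show ?thesis by (simp add: rnorm_sq)
  qed
  have nonneg: "0 \<le> g z u u" for z u by (metis rnorm_sq zero_le_power2)
  have "area_sq x v w = 1" using v w by (simp add: area_sq_def unit_tangent_def rnorm_def)
  then have "(abs_det A g h x)\<^sup>2 = area_sq (h x) (tangent_map A h x v) (tangent_map A h x w)"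
    using area_sq_tangent_map[OF h, of x v w] by simp
  \<comment> \<open>Hadamard's inequality: the square of the mixed product is dropped.\<close>
  also have "\<dots> \<le> g (h x) (tangent_map A h x v) (tangent_map A h x v) * g (h x) (tangent_map A h x w) (tangent_map A h x w)"
    by (simp add: area_sq_def)
  also have "\<dots> \<le> B\<^sup>2 * B\<^sup>2" using le[OF v] le[OF w(1)] nonneg by (intro mult_mono) auto
  finally show "(abs_det A g h x)\<^sup>2 \<le> (B\<^sup>2)\<^sup>2" by (simp add: power2_eq_square)
qed simp

text \<open>A real supremum bounds its members only if the set is bounded above, which the global
  bound on the tangent map guarantees. Then b and M0 dominate nonnegative values, so sqrt b * M0 >=
  0 and the condition leaves 2 b < 1/2.\<close>

lemma abs_det_sufficiently_dissipative:
  assumes M: "compact (UNIV :: 'a set)" and f: "C1_map A f"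
    and diss: "sufficiently_dissipative A g f L" and x: "x \<in> L"
  shows "abs_det A g f x \<le> 1 / 4"
proof -
  obtain B where B: "B \<ge> 0" "\<And>x u. rnorm g (f x) (tangent_map A f x u) \<le> B * rnorm g x u"
    using tangent_map_bounded[OF M f] by blast
  define b where "b = (SUP x\<in>L. abs_det A g f x)"
  define M0 where "M0 = (SUP x\<in>L. tangent_opnorm A g f x)"
  have ineq: "sqrt b * M0 + 2 * b < 1 / 2"
    using diss by (simp add: sufficiently_dissipative_def Let_def b_def M0_def)
  have "bdd_above (abs_det A g f ` L)" using abs_det_le[OF f B(2)] by (intro bdd_aboveI2)
  then have b: "abs_det A g f x \<le> b" unfolding b_def using x by (rule cSUP_upper[rotated])
  have B1: "rnorm g (f y) (tangent_map A f y v) \<le> B" if "v \<in> unit_tangent g y" for y v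
    using B(2)[of y v] that by (simp add: unit_tangent_def)
  have "tangent_opnorm A g f y \<le> B" for y
    unfolding tangent_opnorm_def using unit_tangent_exists B1 by (intro cSUP_least) auto
  then have M0: "tangent_opnorm A g f x \<le> M0"
    unfolding M0_def using x by (intro cSUP_upper bdd_aboveI2)
  obtain v where v: "v \<in> unit_tangent g x" using unit_tangent_exists by blast
  have "0 \<le> rnorm g (f x) (tangent_map A f x v)"
    by (rule rnorm_nonneg)
  also have "\<dots> \<le> tangent_opnorm A g f x"
    unfolding tangent_opnorm_def using v B1 by (intro cSUP_upper bdd_aboveI2)
  finally have "0 \<le> M0" using M0 by simp
  moreover have "0 \<le> b" using b abs_det_nonneg[of f x] by simp
  ultimately have "0 \<le> sqrt b * M0" by simp
  then show ?thesis using ineq b by simp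
qed

text \<open>In the product along the orbit one factor is at most r and the others at most 1; n >= 1
  excludes the empty product.\<close>

lemma abs_det_funpow_le:
  assumes f: "C1_map A f" and le: "\<And>x. x \<in> L \<Longrightarrow> abs_det A g f x \<le> r" and r: "r \<le> 1"
    and L: "f ` L \<subseteq> L" and x: "x \<in> L" and n: "n \<ge> 1"
  shows "abs_det A g (f ^^ n) x \<le> r"
  using n
proof (induction n rule: dec_induct)
  case base
  then show ?case using le[OF x] by simp
next
  case (step n)
  have "(f ^^ n) x \<in> L" using x L by (induction n) auto
  then have "abs_det A g f ((f ^^ n) x) \<le> 1" using le r by fastforce
  then have "abs_det A g f ((f ^^ n) x) * abs_det A g (f ^^ n) x \<le> 1 * abs_det A g (f ^^ n) x"
    using abs_det_nonneg by (intro mult_right_mono)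
  moreover have "abs_det A g (f ^^ Suc n) x = abs_det A g f ((f ^^ n) x) * abs_det A g (f ^^ n) x"
    using abs_det_comp[OF C1_funpow[OF f] f] by (simp only: funpow.simps)
  ultimately show ?case using step.IH by linarith
qed

text \<open>Translates the contraction of f^N to f: if C * \<rho>^m < \<kappa>, then k = N m works,
  for the entire orbit at once because C and \<rho> do not depend on the starting time.\<close>

lemma homothetic_orbit_in_basin:
  assumes M: "compact (UNIV :: 'a set)" and f: "C1_diffeo A f" and N: "N \<ge> 1" and v: "v \<noteq> 0"
    and expan: "\<And>n. n \<ge> 1 \<Longrightarrow> expan ((f ^^ N) ^^ n) x v = 1"
    and s: "0 \<le> s" "s < 1" and det: "\<And>j. abs_det A g (f ^^ N) ((f ^^ (N * j)) x) \<le> s\<^sup>2"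
  shows "\<exists>S. attracting_periodic_orbit f S \<and> x \<in> basin f S"
proof (rule sink_from_contraction[OF M])
  show "C1_map A f" using f by (simp add: C1_diffeo_def)
  fix \<kappa> :: real assume \<kappa>: "\<kappa> > 0"
  have pow: "(f ^^ N) ^^ j = f ^^ (N * j)" for j by (simp add: funpow_mult mult.commute)
  obtain C \<rho> where C: "C > 0" "0 \<le> \<rho>" "\<rho> < 1" "\<And>j n u. rnorm g (((f ^^ N) ^^ (n + j)) x)
      (tangent_map A ((f ^^ N) ^^ n) (((f ^^ N) ^^ j) x) u) \<le> C * \<rho> ^ n * rnorm g (((f ^^ N) ^^ j) x) u"
    using tangent_map_contraction[OF M C1_diffeo_funpow[OF f, of N] v expan s] det unfolding pow by blast
  have "(\<lambda>n. C * \<rho> ^ n) \<longlonglongrightarrow> C * 0" using C by (intro tendsto_intros LIMSEQ_power_zero) simp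
  then have "\<forall>\<^sub>F n in sequentially. C * \<rho> ^ n < \<kappa>" using \<kappa> by (intro order_tendstoD(2)) auto
  then obtain m where m: "m \<ge> 1" "C * \<rho> ^ m < \<kappa>"
    unfolding eventually_sequentially by (meson max.cobounded1 max.cobounded2)
  have "rnorm g ((f ^^ (N * m * Suc j)) x) (tangent_map A (f ^^ (N * m)) ((f ^^ (N * m * j)) x) u)
         \<le> \<kappa> * rnorm g ((f ^^ (N * m * j)) x) u" for j u
  proof -
    have "C * \<rho> ^ m * rnorm g ((f ^^ (N * m * j)) x) u \<le> \<kappa> * rnorm g ((f ^^ (N * m * j)) x) u"
      using m(2) rnorm_nonneg by (intro mult_right_mono) auto
    moreover have "rnorm g ((f ^^ (N * m * Suc j)) x) (tangent_map A (f ^^ (N * m)) ((f ^^ (N * m * j)) x) u)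
         \<le> C * \<rho> ^ m * rnorm g ((f ^^ (N * m * j)) x) u"
      using C(4)[of m "m * j" u] unfolding pow by (simp only: mult.assoc mult_Suc_right distrib_left)
    ultimately show ?thesis by linarith
  qed
  then show "\<exists>k\<ge>1. \<forall>j u. rnorm g ((f ^^ (k * Suc j)) x) (tangent_map A (f ^^ k) ((f ^^ (k * j)) x) u)
         \<le> \<kappa> * rnorm g ((f ^^ (k * j)) x) u"
    using m(1) N by (intro exI[of _ "N * m"]) simp
qed

end

theorem theorem2:
  fixes A :: "'a::t2_space chart set"
    and g :: "'a metric_tensor"
    and f :: "'a \<Rightarrow> 'a"
    and \<Lambda> :: "'a set"
    and N :: nat
  assumes "riemannian_surface A g"
    and "compact (UNIV :: 'a set)"
    and "C1_diffeo A f"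
    and "compact \<Lambda>"
    and "f ` \<Lambda> = \<Lambda>"
    and "sufficiently_dissipative A g f \<Lambda>"
    and "N \<ge> 1"
  shows "far_from_homotheties A g (f ^^ N) (outside_basins f \<Lambda>)"
proof (rule ccontr)
  interpret surface A g by standard (rule assms(1))
  have f: "C1_map A f" "continuous_on UNIV f" using assms(3) by (auto simp: C1_diffeo_def C1_map_def)
  have F: "C1_diffeo A (f ^^ N)" using C1_diffeo_funpow assms(3) .
  assume "\<not> far_from_homotheties A g (f ^^ N) (outside_basins f \<Lambda>)"
  then have "\<exists>x\<in>outside_basins f \<Lambda>. \<exists>v\<in>unit_tangent g x. \<forall>n\<ge>1.
      (1 - \<delta>) ^ n < expan ((f ^^ N) ^^ n) x v \<and> expan ((f ^^ N) ^^ n) x v < (1 + \<delta>) ^ n"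
    if "0 < \<delta>" "\<delta> < 1" for \<delta>
    using that projective_deriv_expan[OF F] unfolding far_from_homotheties_def by fastforce
  \<comment> \<open>Closedness keeps the limit point outside all basins, which the sink found at the
    end contradicts.\<close>
  moreover have "closed (outside_basins f \<Lambda>)"
    using outside_basins_compact[OF f(2) assms(4)] by (rule compact_imp_closed)
  ultimately obtain x v where x: "x \<in> outside_basins f \<Lambda>" and v: "v \<noteq> 0"
    "\<And>n. n \<ge> 1 \<Longrightarrow> expan ((f ^^ N) ^^ n) x v = 1"
    using homothetic_limit[OF assms(2) F] by blast
  have orbit: "(f ^^ j) x \<in> \<Lambda>" for j
    using x assms(5) by (induction j) (auto simp: outside_basins_def)
  \<comment> \<open>The bound 1/4 is written as the square of s = 1/2, the bound on the diagonal
    entries.\<close>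
  have "abs_det A g (f ^^ N) ((f ^^ (N * j)) x) \<le> (1 / 2)\<^sup>2" for j
    using abs_det_funpow_le[OF f(1) abs_det_sufficiently_dissipative[OF assms(2) f(1) assms(6)]
        _ _ orbit assms(7)] assms(5) by (simp add: power2_eq_square)
  then have "\<exists>S. attracting_periodic_orbit f S \<and> x \<in> basin f S"
    by (intro homothetic_orbit_in_basin[OF assms(2,3,7) v, of "1 / 2"]) simp_all
  then show False using x unfolding outside_basins_def by blast
qed

end
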